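(* Let $\{y_t\}$ be generated by $y_{t+1}=\theta^{\tau}\phi(y_t,\ldots,y_{t-n+1})+w_{t+1}$, $t\ge 0$, where $\phi(z_1,\ldots,z_n)=\mathrm{col}\{\phi^{(1)}(z_1),\ldots,\phi^{(n)}(z_n)\}$, and suppose Assumptions A1 and A2 (stated in the context) hold. Let $\lambda_{\min}(t+1)$ be the minimal eigenvalue of $P_{t+1}^{-1}=I_m+\sum_{i=0}^{t}\phi_i\phi_i^{\tau}$, where $\phi_i=\phi(y_i,\ldots,y_{i-n+1})$. Then for any constant $M>0$, $$\liminf_{t\to+\infty}\frac{\lambda_{\min}(t+1)}{N_t(M)}>0\quad\text{a.s. on }\Omega(M),$$ where $N_t(M)=\sum_{i=1}^{t}I_{\{\|Y_i\|\le M\}}$, $Y_i=(y_{i+n-1},\ldots,y_i)^{\tau}$, and $\Omega(M)=\{\lim_{t\to+\infty}N_t(M)=+\infty\}$.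
   Context: Setting. $n\ge1$ and $m_1,\ldots,m_n\ge1$ are integers, $m=\sum_{i=1}^n m_i$. For each $i$, $\phi^{(i)}=(f_{i1},\ldots,f_{im_i})^{\tau}:\mathbb{R}\to\mathbb{R}^{m_i}$ is a known Lebesgue measurable function, and $\phi:\mathbb{R}^n\to\mathbb{R}^m$ is obtained by stacking: $\phi(z_1,\ldots,z_n)=\mathrm{col}\{\phi^{(1)}(z_1),\ldots,\phi^{(n)}(z_n)\}$. $\tau$ denotes transpose, $I_m$ the identity matrix, $I_{\{\cdot\}}$ an indicator. $\theta$ is an $m$-dimensional parameter, $w_t$ are scalar noises, $y_t$ scalar outputs, $y_t=0$ for $t<0$, and $\phi_0$ is the random initial vector of the system. Assumption A1. $\{w_t\}$ is an i.i.d. sequence with $w_1\sim N(0,1)$, and $\theta\sim N(\theta_0,I_m)$ is independent of $\{w_t\}$. Assumption A2. There are open sets $E_1,\ldots,E_n\subset\mathbb{R}$ such that (i) $f_{ij}\in C(\mathbb{R})$ and $f_{ij}\in C^{m_i}(E_i)$ for $1\le j\le m_i$, $1\le i\le n$; (ii) for every unit vector $x\in\mathbb{R}^m$ there is a point $y\in\prod_{i=1}^nE_i$ such that $|\phi^{\tau}(y)x|\ne0$.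
   Formalization: The formal theorem additionally assumes that the pair (θ, y_0) is independent of the noise {w_t : t ≥ 1}; without such a condition on the random initial value y_0 the claim can fail, since y_0 could anticipate the noise. *)

theory Defs
  imports "HOL-Probability.Probability" "Jordan_Normal_Form.Spectral_Radius"
begin

unbundle no vec_syntax and no inner_syntax

text \<open>
  Vectors and matrices are those of \<open>Jordan_Normal_Form\<close>, whose dimensions are natural numbers.
  The indices \<open>i = 1, \<dots>, n\<close> and \<open>j = 1, \<dots>, m\<^sub>i\<close> are shifted to \<open>i < n\<close> and \<open>j < ms i\<close>;
  \<open>f i j\<close> is the \<open>j\<close>-th component of the \<open>i\<close>-th block function.
\<close>

definition vec_norm :: "real vec \<Rightarrow> real" where
  "vec_norm v = sqrt (v \<bullet> v)"

primrec col_stack :: "(nat \<Rightarrow> 'a vec) \<Rightarrow> nat \<Rightarrow> 'a vec" where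
  "col_stack v 0 = vNil"
| "col_stack v (Suc k) = col_stack v k @\<^sub>v v k"

definition phi_block :: "(nat \<Rightarrow> nat) \<Rightarrow> (nat \<Rightarrow> nat \<Rightarrow> real \<Rightarrow> real) \<Rightarrow> nat \<Rightarrow> real \<Rightarrow> real vec" where
  "phi_block ms f i x = vec (ms i) (\<lambda>j. f i j x)"

definition phi :: "nat \<Rightarrow> (nat \<Rightarrow> nat) \<Rightarrow> (nat \<Rightarrow> nat \<Rightarrow> real \<Rightarrow> real) \<Rightarrow> real vec \<Rightarrow> real vec" where
  "phi n ms f z = col_stack (\<lambda>i. phi_block ms f i (z $ i)) n"

definition total_dim :: "nat \<Rightarrow> (nat \<Rightarrow> nat) \<Rightarrow> nat" where
  "total_dim n ms = (\<Sum>i<n. ms i)"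

text \<open>The class \<open>C\<^sup>k(S)\<close>; meant for open \<open>S\<close>, where \<open>deriv\<close> only depends on the values in \<open>S\<close>.\<close>

definition Ck_on :: "nat \<Rightarrow> (real \<Rightarrow> real) \<Rightarrow> real set \<Rightarrow> bool" where
  "Ck_on k g S \<longleftrightarrow>
     (\<forall>l<k. (deriv ^^ l) g differentiable_on S) \<and> (\<forall>l\<le>k. continuous_on S ((deriv ^^ l) g))"

definition coords :: "nat \<Rightarrow> real vec \<Rightarrow> nat \<Rightarrow> real" where
  "coords m v = (\<lambda>j\<in>{..<m}. v $ j)"

text \<open>Density of \<open>N(\<mu>, I\<^sub>m)\<close> with respect to Lebesgue measure on \<open>PiM {..<m} (\<lambda>_. lborel)\<close>.\<close>

definition mv_normal_density :: "nat \<Rightarrow> real vec \<Rightarrow> (nat \<Rightarrow> real) \<Rightarrow> real" where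
  "mv_normal_density m \<mu> x =
     (2 * pi) powr (- real m / 2) * exp (- (\<Sum>j<m. (x j - \<mu> $ j)\<^sup>2) / 2)"

definition noise_path :: "(nat \<Rightarrow> 'a \<Rightarrow> real) \<Rightarrow> 'a \<Rightarrow> nat \<Rightarrow> real" where
  "noise_path w \<omega> = (\<lambda>t\<in>{1..}. w t \<omega>)"

definition assumption_A1 ::
  "'a measure \<Rightarrow> nat \<Rightarrow> (nat \<Rightarrow> 'a \<Rightarrow> real) \<Rightarrow> ('a \<Rightarrow> real vec) \<Rightarrow> real vec \<Rightarrow> bool" where
  "assumption_A1 Pr m w \<theta> \<theta>\<^sub>0 \<longleftrightarrow>
     prob_space.indep_vars Pr (\<lambda>_. borel) w {1..} \<and>
     (\<forall>t\<ge>1. distr Pr borel (w t) = distr Pr borel (w 1)) \<and>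
     distributed Pr lborel (w 1) std_normal_density \<and>
     \<theta>\<^sub>0 \<in> carrier_vec m \<and>
     (\<forall>\<omega>\<in>space Pr. \<theta> \<omega> \<in> carrier_vec m) \<and>
     distributed Pr (PiM {..<m} (\<lambda>_. lborel)) (\<lambda>\<omega>. coords m (\<theta> \<omega>)) (mv_normal_density m \<theta>\<^sub>0) \<and>
     prob_space.indep_var Pr
       (PiM {..<m} (\<lambda>_. borel)) (\<lambda>\<omega>. coords m (\<theta> \<omega>))
       (PiM {1..} (\<lambda>_. borel)) (noise_path w)"

definition assumption_A2 ::
  "nat \<Rightarrow> (nat \<Rightarrow> nat) \<Rightarrow> (nat \<Rightarrow> nat \<Rightarrow> real \<Rightarrow> real) \<Rightarrow> bool" where
  "assumption_A2 n ms f \<longleftrightarrow>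
     (\<exists>E. (\<forall>i<n. open (E i)) \<and>
          (\<forall>i<n. \<forall>j<ms i. continuous_on UNIV (f i j) \<and> Ck_on (ms i) (f i j) (E i)) \<and>
          (\<forall>x\<in>carrier_vec (total_dim n ms). vec_norm x = 1 \<longrightarrow>
             (\<exists>y\<in>carrier_vec n. (\<forall>i<n. y $ i \<in> E i) \<and> \<bar>phi n ms f y \<bullet> x\<bar> \<noteq> 0)))"

text \<open>
  As \<open>y\<^sub>t = 0\<close> for \<open>t < 0\<close>, the random initial vector \<open>\<phi>\<^sub>0 = \<phi>(y\<^sub>0, 0, \<dots>, 0)\<close> is determined by
  \<open>y\<^sub>0\<close>. Being initial data, \<open>y\<^sub>0\<close> must not anticipate the noise: \<open>(\<theta>, y\<^sub>0)\<close> is independent of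
  \<open>(w\<^sub>t)\<^sub>t\<^sub>\<ge>\<^sub>1\<close>. It may depend on \<open>\<theta>\<close> in any way, and may be deterministic.
\<close>

definition initial_data ::
  "'a measure \<Rightarrow> nat \<Rightarrow> (nat \<Rightarrow> 'a \<Rightarrow> real) \<Rightarrow> ('a \<Rightarrow> real vec) \<Rightarrow> (int \<Rightarrow> 'a \<Rightarrow> real) \<Rightarrow> bool" where
  "initial_data Pr m w \<theta> y \<longleftrightarrow>
     (\<forall>t<0. \<forall>\<omega>\<in>space Pr. y t \<omega> = 0) \<and>
     y 0 \<in> borel_measurable Pr \<and>
     prob_space.indep_set Pr
       (sets (vimage_algebra (space Pr) (\<lambda>\<omega>. (coords m (\<theta> \<omega>), y 0 \<omega>))
          (PiM {..<m} (\<lambda>_. borel) \<Otimes>\<^sub>M borel)))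
       (sets (vimage_algebra (space Pr) (noise_path w) (PiM {1..} (\<lambda>_. borel))))"

definition regressor ::
  "nat \<Rightarrow> (nat \<Rightarrow> nat) \<Rightarrow> (nat \<Rightarrow> nat \<Rightarrow> real \<Rightarrow> real) \<Rightarrow> (int \<Rightarrow> 'a \<Rightarrow> real) \<Rightarrow> nat \<Rightarrow> 'a \<Rightarrow> real vec"
  where
  "regressor n ms f y t \<omega> = phi n ms f (vec n (\<lambda>k. y (int t - int k) \<omega>))"

text \<open>\<open>info_matrix\<close> at \<open>t\<close> is \<open>P\<^sub>t\<^sub>+\<^sub>1\<^sup>-\<^sup>1 = I\<^sub>m + \<Sum>\<^sub>i\<^sub>\<le>\<^sub>t \<phi>\<^sub>i \<phi>\<^sub>i\<^sup>\<tau>\<close>, the sum being written entrywise.\<close>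

definition info_matrix ::
  "nat \<Rightarrow> (nat \<Rightarrow> nat) \<Rightarrow> (nat \<Rightarrow> nat \<Rightarrow> real \<Rightarrow> real) \<Rightarrow> (int \<Rightarrow> 'a \<Rightarrow> real) \<Rightarrow> nat \<Rightarrow> 'a \<Rightarrow> real mat"
  where
  "info_matrix n ms f y t \<omega> =
     1\<^sub>m (total_dim n ms) +
     mat (total_dim n ms) (total_dim n ms)
       (\<lambda>(j, k). \<Sum>i=0..t. regressor n ms f y i \<omega> $ j * regressor n ms f y i \<omega> $ k)"

definition min_eigenvalue :: "real mat \<Rightarrow> real" where
  "min_eigenvalue A = Min (spectrum A)"

definition Y_vec :: "nat \<Rightarrow> (int \<Rightarrow> 'a \<Rightarrow> real) \<Rightarrow> nat \<Rightarrow> 'a \<Rightarrow> real vec" where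
  "Y_vec n y i \<omega> = vec n (\<lambda>k. y (int i + int n - 1 - int k) \<omega>)"

definition N_count :: "nat \<Rightarrow> (int \<Rightarrow> 'a \<Rightarrow> real) \<Rightarrow> real \<Rightarrow> nat \<Rightarrow> 'a \<Rightarrow> real" where
  "N_count n y M t \<omega> = (\<Sum>i=1..t. indicator {\<omega>'. vec_norm (Y_vec n y i \<omega>') \<le> M} \<omega>)"

definition Omega_set :: "'a measure \<Rightarrow> nat \<Rightarrow> (int \<Rightarrow> 'a \<Rightarrow> real) \<Rightarrow> real \<Rightarrow> 'a set" where
  "Omega_set Pr n y M = {\<omega>\<in>space Pr. filterlim (\<lambda>t. N_count n y M t \<omega>) at_top sequentially}"

end

theory Submission
  imports Defs
begin

text \<open>
  For almost every \<open>\<omega>\<close> the window \<open>Y\<^sub>i\<close> visits a fixed neighbourhood of any given point of \<open>\<real>\<^sup>n\<close> with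
  positive frequency relative to \<open>N\<^sub>t(M)\<close>. Indeed, while the last \<open>n\<close> outputs are bounded, so is
  \<open>\<theta>\<^sup>\<tau>\<phi>\<^sub>t\<close>, hence the next output, conditionally Gaussian with unit variance, hits a given interval
  with conditional probability bounded below; this is applied \<open>n\<close> times in a row, one coordinate of
  the target box at a time. By continuity of \<open>\<phi>\<close>, nondegeneracy and compactness of the unit sphere,
  finitely many boxes suffice to make \<open>|\<phi>(z)\<^sup>\<tau>x| \<ge> \<delta>\<close> on one of them for each unit vector \<open>x\<close>,
  so every Rayleigh quotient of the information matrix is at least a constant times \<open>N\<^sub>t(M)\<close>.
\<close>

section \<open>Frequency of successes in dependent trials\<close>

text \<open>Two difficulties shape the argument. The number of trials made by time t is random and
  the trials are dependent, so no law of large numbers applies directly; an exponential moment bound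
  that uses only a lower bound on conditional success probabilities takes its place. Moreover the
  bound on the inner product of \<open>\<theta>\<close> with the regressor depends on
  \<open>\<theta>\<close>, which is random and unbounded, so no single success rate serves all
  paths. \<open>\<theta>\<close> is therefore made part of the information at time 0, trials are
  restricted to integer levels of that inner product, and each path picks a sufficient level after
  one null set has been discarded for all levels together. The resulting frequency depends on the
  path, which is compatible with a pathwise positive liminf.\<close>

definition hits :: "(nat \<Rightarrow> 'a set) \<Rightarrow> nat \<Rightarrow> 'a \<Rightarrow> nat" where
  "hits A t \<omega> = (\<Sum>s<t. of_bool (\<omega> \<in> A s))"

lemma hits_0 [simp]: "hits A 0 \<omega> = 0"
  by (simp add: hits_def)

lemma hits_Suc: "hits A (Suc t) \<omega> = hits A t \<omega> + of_bool (\<omega> \<in> A t)"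
  by (simp add: hits_def)

lemma hits_mono: "s \<le> t \<Longrightarrow> hits A s \<omega> \<le> hits A t \<omega>"
  unfolding hits_def by (rule sum_mono2) auto

lemma hits_le: "hits A t \<omega> \<le> t"
  by (induction t) (auto simp: hits_Suc)

lemma frequently_iff_hits_unbounded: "(\<exists>\<^sub>\<infinity>t. \<omega> \<in> A t) \<longleftrightarrow> (\<forall>k. \<exists>t. k \<le> hits A t \<omega>)"
proof (intro iffI allI)
  fix k assume inf: "\<exists>\<^sub>\<infinity>t. \<omega> \<in> A t"
  show "\<exists>t. k \<le> hits A t \<omega>"
  proof (induction k)
    case (Suc k)
    then obtain t where t: "k \<le> hits A t \<omega>" by auto
    from inf obtain s where s: "s \<ge> t" "\<omega> \<in> A s" by (auto simp: INFM_nat_le)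
    have "Suc k \<le> hits A (Suc s) \<omega>" using t s hits_mono[of t s A \<omega>] by (auto simp: hits_Suc)
    then show ?case by blast
  qed auto
next
  assume unb: "\<forall>k. \<exists>t. k \<le> hits A t \<omega>"
  show "\<exists>\<^sub>\<infinity>t. \<omega> \<in> A t"
  proof (rule ccontr)
    assume "\<not> (\<exists>\<^sub>\<infinity>t. \<omega> \<in> A t)"
    then obtain N where N: "\<And>t. t \<ge> N \<Longrightarrow> \<omega> \<notin> A t" by (auto simp: INFM_nat_le)
    have "hits A t \<omega> \<le> N" for t
    proof (induction t)
      case (Suc t)
      then show ?case using hits_le[of A "Suc t" \<omega>] N[of t] by (cases "t < N") (auto simp: hits_Suc)
    qed auto
    then show False using unb Suc_n_not_le_n le_trans by blast
  qed
qed

text \<open>Translates between two clocks: the trial belonging to a window at t is carried out k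
  steps later, so \<open>A\<close> is indexed by the time of the trial and \<open>B\<close> by the
  time of the window.\<close>

lemma hits_shift:
  assumes "\<And>s. s < k \<Longrightarrow> \<omega> \<notin> A s" "\<And>t. \<omega> \<in> A (t + k) \<longleftrightarrow> \<omega> \<in> B t"
  shows "hits A (T + k) \<omega> = hits B T \<omega>"
proof (induction T)
  case 0
  then show ?case using assms(1) by (simp add: hits_def)
next
  case (Suc T)
  then show ?case using assms(2)[of T] by (simp add: hits_Suc)
qed

lemma hits_add_le: "hits A (t + d) \<omega> \<le> hits A t \<omega> + d"
  by (induction d) (auto simp: hits_Suc)

text \<open>As \<open>hits\<close> counts strictly earlier indices, it is known at time t whether a
  trial at t is still among the first k; the truncated trials stay adapted.\<close>

definition first_hits :: "nat \<Rightarrow> (nat \<Rightarrow> 'a set) \<Rightarrow> nat \<Rightarrow> 'a set" where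
  "first_hits k A t = {\<omega> \<in> A t. hits A t \<omega> < k}"

lemma hits_first_hits: "hits (first_hits k A) t \<omega> = min k (hits A t \<omega>)"
  by (induction t) (auto simp: hits_Suc first_hits_def)

text \<open>\<open>success_rate\<close> says that the conditional probability of \<open>B t\<close>
  given \<open>F t\<close> is at least \<open>c\<close> on \<open>A t\<close>, in integrated form:
  it is tested against bounded nonnegative \<open>F t\<close>-measurable \<open>Z\<close>, so no
  conditional expectation has to be handled. The outcome \<open>B t\<close> is revealed one step
  after the decision \<open>A t\<close>.\<close>

locale lower_bounded_trials = prob_space M for M :: "'a measure" +
  fixes F :: "nat \<Rightarrow> 'a measure" and A B :: "nat \<Rightarrow> 'a set" and c :: real
  assumes subalg: "\<And>t. subalgebra M (F t)"
    and filtration: "\<And>s t. s \<le> t \<Longrightarrow> sets (F s) \<subseteq> sets (F t)"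
    and trial: "\<And>t. A t \<in> sets (F t)"
    and success: "\<And>t. B t \<in> sets (F (Suc t))"
    and rate: "0 < c" "c < 1"
    and success_rate: "\<And>t Z K. Z \<in> borel_measurable (F t) \<Longrightarrow> (\<And>\<omega>. 0 \<le> Z \<omega>) \<Longrightarrow> (\<And>\<omega>. Z \<omega> \<le> K) \<Longrightarrow>
      c * (\<integral>\<omega>. Z \<omega> * indicator (A t) \<omega> \<partial>M) \<le> (\<integral>\<omega>. Z \<omega> * indicator (A t \<inter> B t) \<omega> \<partial>M)"
begin

lemma measurable_hits_adapted:
  assumes "\<And>s. s < t \<Longrightarrow> C s \<in> sets (F t)"
  shows "hits C t \<in> measurable (F t) (count_space UNIV)"
proof -
  have [measurable]: "Measurable.pred (F t) (\<lambda>\<omega>. \<omega> \<in> C s)" if "s < t" for s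
    using assms[OF that] by (intro pred_sets2[OF _ measurable_ident_sets]) auto
  have "hits C r \<in> measurable (F t) (count_space UNIV)" if "r \<le> t" for r
    using that
  proof (induction r)
    case (Suc r)
    then have [measurable]: "hits C r \<in> measurable (F t) (count_space UNIV)"
       and [simp]: "r < t" by auto
    have "(\<lambda>\<omega>. hits C r \<omega> + of_bool (\<omega> \<in> C r)) \<in> measurable (F t) (count_space UNIV)"
      by measurable
    then show ?case by (simp add: hits_Suc[abs_def])
  qed (simp add: hits_def[abs_def])
  then show ?thesis by auto
qed

lemma measurable_trials: "hits A t \<in> measurable (F t) (count_space UNIV)"
  by (rule measurable_hits_adapted) (use trial filtration in \<open>meson less_imp_le subsetD\<close>)

text \<open>Trials counted at t were made strictly before t, so their outcomes are already revealed
  in \<open>F t\<close>.\<close>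

lemma measurable_successes: "hits (\<lambda>s. A s \<inter> B s) t \<in> measurable (F t) (count_space UNIV)"
proof (rule measurable_hits_adapted)
  fix s assume "s < t"
  then have "sets (F s) \<subseteq> sets (F t)" "sets (F (Suc s)) \<subseteq> sets (F t)"
    by (auto intro!: filtration)
  then show "A s \<inter> B s \<in> sets (F t)" using trial[of s] success[of s] by blast
qed

text \<open>
  An exponential supermartingale: each trial multiplies the expectation by at most
  \<open>(1 - c + c/2) / (1 - c/2) = 1\<close>.
\<close>

definition trial_weight :: "nat \<Rightarrow> 'a \<Rightarrow> real" where
  "trial_weight t \<omega> = (1/2) ^ hits (\<lambda>s. A s \<inter> B s) t \<omega> / (1 - c/2) ^ hits A t \<omega>"

lemma trial_weight_nonneg: "0 \<le> trial_weight t \<omega>"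
  using rate by (simp add: trial_weight_def)

text \<open>A crude bound, growing with t; it provides integrability and makes the weight an
  admissible test variable in \<open>success_rate\<close>.\<close>

lemma trial_weight_le: "trial_weight t \<omega> \<le> 1 / (1 - c/2) ^ t"
proof -
  have "(1 - c/2) ^ t \<le> (1 - c/2) ^ hits A t \<omega>"
    using rate by (intro power_decreasing hits_le) auto
  moreover have "(1/2::real) ^ hits (\<lambda>s. A s \<inter> B s) t \<omega> \<le> 1"
    by (simp add: power_le_one)
  ultimately show ?thesis
    unfolding trial_weight_def using rate by (intro frac_le) auto
qed

lemma trial_weight_measurable: "trial_weight t \<in> borel_measurable (F t)"
proof -
  note measurable_trials[measurable] measurable_successes[measurable]
  show ?thesis unfolding trial_weight_def[abs_def] by measurable
qed

lemma expectation_trial_weight_le: "expectation (trial_weight t) \<le> 1"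
proof (induction t)
  case 0
  show ?case by (simp add: trial_weight_def prob_space)
next
  case (Suc t)
  have sets[measurable]: "A t \<in> events" "B t \<in> events"
    using trial[of t] success[of t] subalg unfolding subalgebra_def by auto
  have [measurable]: "trial_weight t \<in> borel_measurable M"
    using trial_weight_measurable subalg by (rule measurable_from_subalg[rotated])
  have int: "integrable M (\<lambda>\<omega>. trial_weight t \<omega> * indicator C \<omega>)" if [measurable]: "C \<in> events" for C
    by (rule integrable_const_bound[where B="1 / (1 - c/2) ^ t"])
      (use trial_weight_nonneg trial_weight_le rate in \<open>auto simp: indicator_def\<close>)
  have int0: "integrable M (trial_weight t)"
    by (rule integrable_const_bound[where B="1 / (1 - c/2) ^ t"])
      (use trial_weight_nonneg trial_weight_le rate in \<open>auto simp: indicator_def\<close>)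
  define r where "r = 1 - c/2"
  have r: "r > 0" using rate by (simp add: r_def)
  \<comment> \<open>One step multiplies the weight by 1 off \<open>A t\<close>, by 1/r at a failed
    trial and by 1/(2r) at a successful one; two indicators express this factor.\<close>
  have step: "trial_weight (Suc t) \<omega> = trial_weight t \<omega> + (1/r - 1) * (trial_weight t \<omega> * indicator (A t) \<omega>)
      - 1/(2*r) * (trial_weight t \<omega> * indicator (A t \<inter> B t) \<omega>)" for \<omega>
    using r by (auto simp: trial_weight_def hits_Suc r_def[symmetric] indicator_def field_simps)
  have "expectation (trial_weight (Suc t)) = expectation (trial_weight t)
      + (1/r - 1) * expectation (\<lambda>\<omega>. trial_weight t \<omega> * indicator (A t) \<omega>)
      - 1/(2*r) * expectation (\<lambda>\<omega>. trial_weight t \<omega> * indicator (A t \<inter> B t) \<omega>)"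
    unfolding step[abs_def] using int int0 by simp
  also have "\<dots> \<le> expectation (trial_weight t)
      + (1/r - 1) * expectation (\<lambda>\<omega>. trial_weight t \<omega> * indicator (A t) \<omega>)
      - 1/(2*r) * (c * expectation (\<lambda>\<omega>. trial_weight t \<omega> * indicator (A t) \<omega>))"
    using r by (intro diff_left_mono mult_left_mono success_rate[OF trial_weight_measurable trial_weight_nonneg trial_weight_le]) auto
  also have "\<dots> = expectation (trial_weight t)"
  proof -
    have "1/r - 1 = 1/(2*r) * c" using r by (simp add: r_def field_simps)
    then show ?thesis by (simp only: mult.assoc add_diff_cancel_right')
  qed
  finally show ?case using Suc by simp
qed

text \<open>A Chernoff bound: many trials with few successes force the weight up to at least
  \<open>a\<close>, and Markov's inequality with expectation at most 1 gives 1/a. The bound is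
  uniform in t.\<close>

lemma prob_few_successes_le:
  fixes e :: real
  assumes "0 \<le> e"
  shows "prob {\<omega> \<in> space M. k \<le> hits A t \<omega> \<and> hits (\<lambda>s. A s \<inter> B s) t \<omega> \<le> e * k}
    \<le> (2 powr e * (1 - c/2)) ^ k" (is "prob ?D \<le> _")
proof -
  define r where "r = 1 - c/2"
  have r: "0 < r" "r < 1" using rate by (auto simp: r_def)
  note m = measurable_from_subalg[OF subalg]
  note m[OF measurable_trials, measurable] m[OF measurable_successes, measurable] m[OF trial_weight_measurable, measurable]
  define a where "a = (1/2) powr (e * k) / r ^ k"
  have a: "a > 0" using r by (simp add: a_def)
  have int0: "integrable M (trial_weight t)"
    by (rule integrable_const_bound[where B="1 / (1 - c/2) ^ t"])
      (use trial_weight_nonneg trial_weight_le rate in \<open>auto simp: indicator_def\<close>)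
  have "?D \<subseteq> {\<omega> \<in> space M. a \<le> trial_weight t \<omega>}"
  proof safe
    fix \<omega> assume *: "k \<le> hits A t \<omega>" "hits (\<lambda>s. A s \<inter> B s) t \<omega> \<le> e * k"
    have "(1/2::real) powr (e * k) \<le> (1/2) powr (real (hits (\<lambda>s. A s \<inter> B s) t \<omega>))"
      using * by (intro powr_mono') auto
    also have "\<dots> = (1/2) ^ hits (\<lambda>s. A s \<inter> B s) t \<omega>"
      by (simp add: powr_realpow)
    moreover have "r ^ hits A t \<omega> \<le> r ^ k" using r * by (intro power_decreasing) auto
    ultimately show "a \<le> trial_weight t \<omega>"
      unfolding a_def trial_weight_def r_def[symmetric] using r by (intro frac_le) auto
  qed
  then have "prob ?D \<le> prob {\<omega> \<in> space M. a \<le> trial_weight t \<omega>}"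
    by (intro finite_measure_mono) auto
  also have "\<dots> \<le> expectation (trial_weight t) / a"
    by (rule integral_Markov_inequality_measure[OF int0, of "{}"]) (use a trial_weight_nonneg in auto)
  also have "\<dots> \<le> 1 / a"
    using a expectation_trial_weight_le by (simp add: divide_right_mono)
  also have "\<dots> = (2 powr e * r) ^ k"
  proof -
    have "(1/2::real) powr (e * k) = 1 / (2 powr e) ^ k"
      by (simp add: powr_divide powr_powr[symmetric] powr_realpow)
    then show ?thesis by (simp add: a_def power_mult_distrib)
  qed
  finally show ?thesis by (simp add: r_def)
qed

text \<open>The cut-off \<open>hits A t \<omega> < k\<close> is known at time t, so it can be
  absorbed into the test variable \<open>V\<close>.\<close>

lemma first_trials: "lower_bounded_trials M F (first_hits k A) B c"
proof (unfold_locales)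
  note measurable_trials[measurable] trial[measurable]
  have eq: "first_hits k A t = A t \<inter> {\<omega> \<in> space (F t). hits A t \<omega> < k}" for t
    using sets.sets_into_space[OF trial[of t]] by (auto simp: first_hits_def)
  show "first_hits k A t \<in> sets (F t)" for t
    unfolding eq by measurable
  fix t K and V :: "'a \<Rightarrow> real"
  assume [measurable]: "V \<in> borel_measurable (F t)" and V: "\<And>\<omega>. 0 \<le> V \<omega>" "\<And>\<omega>. V \<omega> \<le> K"
  let ?V = "\<lambda>\<omega>. if hits A t \<omega> < k then V \<omega> else 0"
  have "K \<ge> 0" using V order_trans by blast
  have 1: "V \<omega> * indicator (first_hits k A t) \<omega> = ?V \<omega> * indicator (A t) \<omega>"
    "V \<omega> * indicator (first_hits k A t \<inter> B t) \<omega> = ?V \<omega> * indicator (A t \<inter> B t) \<omega>" for \<omega>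
    by (auto simp: first_hits_def indicator_def)
  show "c * (\<integral>\<omega>. V \<omega> * indicator (first_hits k A t) \<omega> \<partial>M)
      \<le> (\<integral>\<omega>. V \<omega> * indicator (first_hits k A t \<inter> B t) \<omega> \<partial>M)"
    unfolding 1 by (rule success_rate[where K=K]) (use V \<open>K \<ge> 0\<close> in auto)
qed (use subalg filtration success rate in auto)

text \<open>
  Stopping at the \<open>k\<close>-th trial makes the bounds summable in \<open>k\<close>; the exponent \<open>e\<close> is chosen such that
  \<open>2\<^sup>e (1 - c/2) = (1 - c/2)\<^sup>1\<^sup>/\<^sup>2\<close>.
\<close>

theorem AE_successes_ge:
  "\<exists>e>0::real. AE \<omega> in M. (\<exists>\<^sub>\<infinity>t. \<omega> \<in> A t) \<longrightarrow>
     (\<forall>\<^sub>F t in sequentially. e * hits A t \<omega> \<le> hits (\<lambda>s. A s \<inter> B s) t \<omega>)"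
proof -
  define r where "r = 1 - c/2"
  have r: "0 < r" "r < 1" using rate by (auto simp: r_def)
  define e where "e = - ln r / (2 * ln 2)"
  have e: "e > 0" using r by (simp add: e_def divide_neg_pos)
  have "2 powr e * r = sqrt r"
  proof -
    have "2 powr e * r = exp (e * ln 2) * exp (ln r)" using r by (simp add: powr_def)
    also have "\<dots> = exp (e * ln 2 + ln r)" by (simp only: exp_add)
    also have "e * ln 2 + ln r = ln r / 2" by (simp add: e_def)
    also have "exp (ln r / 2) = sqrt r" using r by (simp add: powr_half_sqrt[symmetric] powr_def)
    finally show ?thesis .
  qed
  then have q: "0 \<le> 2 powr e * r" "2 powr e * r < 1" using r by auto
  define D where "D k t = {\<omega> \<in> space M. k \<le> hits (first_hits k A) t \<omega> \<and>
    hits (\<lambda>s. first_hits k A s \<inter> B s) t \<omega> \<le> e * k}" for k t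
  have pD: "prob (D k t) \<le> (2 powr e * r) ^ k" for k t
  proof -
    interpret fs: lower_bounded_trials M F "first_hits k A" B c by (rule first_trials)
    show ?thesis using fs.prob_few_successes_le[of e k t] e by (simp add: D_def r_def)
  qed
  have mD[measurable]: "D k t \<in> events" for k t
  proof -
    interpret fs: lower_bounded_trials M F "first_hits k A" B c by (rule first_trials)
    note measurable_from_subalg[OF subalg fs.measurable_trials, measurable]
       measurable_from_subalg[OF subalg fs.measurable_successes, measurable]
    show ?thesis unfolding D_def by measurable
  qed
  \<comment> \<open>Once k trials are made both truncated counts are frozen. Hence the events
    increase with t, and their union over t inherits the uniform bound.\<close>
  have inc: "incseq (D k)" for k
  proof (rule incseq_SucI, rule subsetI)
    fix t \<omega> assume *: "\<omega> \<in> D k t"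
    then have "hits A t \<omega> \<ge> k" by (auto simp: D_def hits_first_hits)
    then show "\<omega> \<in> D k (Suc t)" using * by (auto simp: D_def hits_Suc) (auto simp: first_hits_def)
  qed
  define E where "E k = (\<Union>t. D k t)" for k
  have mE[measurable]: "E k \<in> events" for k by (auto simp: E_def)
  have pE: "prob (E k) \<le> (2 powr e * r) ^ k" for k
  proof -
    have "(\<lambda>t. prob (D k t)) \<longlonglongrightarrow> prob (E k)"
      unfolding E_def by (rule finite_Lim_measure_incseq) (use inc mD in auto)
    then show ?thesis by (rule LIMSEQ_le_const2) (use pD in auto)
  qed
  have "summable (\<lambda>k. prob (E k))"
    by (rule summable_comparison_test'[where g="\<lambda>k. (2 powr e * r) ^ k" and N=0])
      (use q pE in \<open>auto intro: summable_geometric\<close>)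
  then have "AE \<omega> in M. \<forall>\<^sub>F k in sequentially. \<omega> \<in> space M - E k"
    by (intro borel_cantelli_AE1) (auto simp: emeasure_eq_measure)
  then have "AE \<omega> in M. (\<exists>\<^sub>\<infinity>t. \<omega> \<in> A t) \<longrightarrow>
     (\<forall>\<^sub>F t in sequentially. e * hits A t \<omega> \<le> hits (\<lambda>s. A s \<inter> B s) t \<omega>)"
  proof (eventually_elim, intro impI)
    fix \<omega> assume ev: "\<forall>\<^sub>F k in sequentially. \<omega> \<in> space M - E k" and inf: "\<exists>\<^sub>\<infinity>t. \<omega> \<in> A t"
    from ev obtain k0 where k0: "\<And>k. k \<ge> k0 \<Longrightarrow> \<omega> \<in> space M - E k"
      by (auto simp: eventually_sequentially)
    from inf obtain t0 where t0: "hits A t0 \<omega> \<ge> k0"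
      unfolding frequently_iff_hits_unbounded by blast
    show "\<forall>\<^sub>F t in sequentially. e * hits A t \<omega> \<le> hits (\<lambda>s. A s \<inter> B s) t \<omega>"
      unfolding eventually_sequentially
    proof (intro exI allI impI)
      fix t assume "t0 \<le> t"
      \<comment> \<open>Borel-Cantelli ran over k, not over time. It is evaluated at the number of
        trials made by time t, for which the first k trials are all those made so far.\<close>
      define k where "k = hits A t \<omega>"
      have "k \<ge> k0" using t0 hits_mono[OF \<open>t0 \<le> t\<close>, of A \<omega>] by (simp add: k_def)
      from k0[OF this] have "\<omega> \<in> space M" "\<omega> \<notin> D k t" by (auto simp: E_def)
      then have "e * k < hits (\<lambda>s. first_hits k A s \<inter> B s) t \<omega>"
        by (auto simp: D_def hits_first_hits k_def not_le)
      also have "hits (\<lambda>s. first_hits k A s \<inter> B s) t \<omega> \<le> hits (\<lambda>s. A s \<inter> B s) t \<omega>"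
        unfolding hits_def by (rule sum_mono) (auto simp: first_hits_def)
      finally show "e * hits A t \<omega> \<le> hits (\<lambda>s. A s \<inter> B s) t \<omega>" by (simp add: k_def)
    qed
  qed
  with e show ?thesis by (intro exI[of _ e] conjI)
qed

end

section \<open>Outputs driven by Gaussian innovations\<close>

text \<open>The density decreases in the modulus, and every point of the shifted interval has
  modulus at most \<open>R\<close>; density at \<open>R\<close> times length is the required mass.
  The cap 1/2 keeps the rate below 1.\<close>

lemma std_normal_interval_ge:
  fixes a b L :: real
  assumes "a < b"
  obtains c where "0 < c" "c < 1"
    "\<And>u. \<bar>u\<bar> \<le> L \<Longrightarrow> ennreal c \<le> emeasure (density lborel std_normal_density) {x. a < u + x \<and> u + x < b}"
proof
  define R where "R = \<bar>a\<bar> + \<bar>b\<bar> + \<bar>L\<bar>"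
  define d where "d = std_normal_density R"
  have d: "d > 0" by (simp add: d_def normal_density_pos)
  show "0 < min (d * (b - a)) (1/2)" "min (d * (b - a)) (1/2) < (1::real)" using d assms by auto
  fix u assume u: "\<bar>u\<bar> \<le> L"
  have S: "{x. a < u + x \<and> u + x < b} = {a - u<..<b - u}" by auto
  have le: "ennreal d * indicator {a - u<..<b - u} x \<le> ennreal (std_normal_density x) * indicator {a - u<..<b - u} x" for x
  proof (cases "x \<in> {a - u<..<b - u}")
    case True
    then have "\<bar>x\<bar> \<le> \<bar>R\<bar>" using u unfolding R_def by auto
    then have "x\<^sup>2 \<le> R\<^sup>2" by (simp only: abs_le_square_iff)
    then show ?thesis using True by (auto simp: d_def std_normal_density_def intro!: ennreal_leI divide_right_mono)
  qed auto
  have "ennreal (min (d * (b - a)) (1/2)) \<le> ennreal (d * (b - a))"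
    by (intro ennreal_leI) auto
  also have "\<dots> = ennreal d * emeasure lborel {a - u<..<b - u}"
    using d assms by (simp add: ennreal_mult)
  also have "\<dots> = (\<integral>\<^sup>+x. ennreal d * indicator {a - u<..<b - u} x \<partial>lborel)"
    by (simp add: nn_integral_cmult_indicator)
  also have "\<dots> \<le> (\<integral>\<^sup>+x. ennreal (std_normal_density x) * indicator {a - u<..<b - u} x \<partial>lborel)"
    by (intro nn_integral_mono le)
  also have "\<dots> = emeasure (density lborel std_normal_density) {x. a < u + x \<and> u + x < b}"
    unfolding S by (rule emeasure_density[symmetric]) auto
  finally show "ennreal (min (d * (b - a)) (1/2)) \<le> emeasure (density lborel std_normal_density) {x. a < u + x \<and> u + x < b}" .
qed

text \<open>
  \<open>X\<close> collects everything known at time \<open>0\<close>, here the parameter together with \<open>y\<^sub>0\<close>.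
\<close>

locale innovations = prob_space M for M :: "'a measure" +
  fixes X :: "'a \<Rightarrow> 'b" and N :: "'b measure" and w :: "nat \<Rightarrow> 'a \<Rightarrow> real"
  assumes X_measurable: "X \<in> measurable M N"
    and indep_noise: "indep_vars (\<lambda>_. borel) w {1..}"
    and std_normal: "\<And>t. t \<ge> 1 \<Longrightarrow> distr M borel (w t) = density lborel std_normal_density"
    and indep_initial: "indep_set (sets (vimage_algebra (space M) X N))
       (sets (vimage_algebra (space M) (noise_path w) (PiM {1..} (\<lambda>_. borel))))"
begin

section \<open>The filtration generated by the initial data and the noise\<close>

lemma w_measurable: "t \<ge> 1 \<Longrightarrow> w t \<in> borel_measurable M"
  using indep_noise unfolding indep_vars_def2 by auto

text \<open>An intersection-stable generator of the information in \<open>X\<close> and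
  \<open>w 1\<close>, ..., \<open>w t\<close>. At t = 0 the inner intersection is
  \<open>UNIV\<close>, leaving the events of \<open>X\<close> alone.\<close>

definition cylinders :: "nat \<Rightarrow> 'a set set" where
  "cylinders t = {X -` A \<inter> space M \<inter> (\<Inter>s\<in>{1..t}. w s -` C s) | A C. A \<in> sets N \<and> (\<forall>s. C s \<in> sets borel)}"

definition history :: "nat \<Rightarrow> 'a measure" where
  "history t = sigma (space M) (cylinders t)"

lemma cylinders_subset: "cylinders t \<subseteq> Pow (space M)"
  by (auto simp: cylinders_def)

lemma space_history [simp]: "space (history t) = space M"
  by (simp add: history_def cylinders_subset space_measure_of_conv)

lemma sets_history: "sets (history t) = sigma_sets (space M) (cylinders t)"
  by (simp add: history_def cylinders_subset sets_measure_of)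

text \<open>Links the two independence assumptions: the first claim places finite noise events in
  the sigma-algebra of the whole path, where \<open>indep_initial\<close> applies; the second
  factors them by \<open>indep_noise\<close>. \<open>J\<close> may be empty, as happens at time
  0.\<close>

lemma noise_event:
  assumes "J \<subseteq> {1..}" "finite J" "\<And>s. C s \<in> sets borel"
  shows "(\<Inter>s\<in>J. w s -` C s) \<inter> space M
     \<in> sets (vimage_algebra (space M) (noise_path w) (PiM {1..} (\<lambda>_. borel)))"
    and "prob ((\<Inter>s\<in>J. w s -` C s) \<inter> space M) = (\<Prod>s\<in>J. prob (w s -` C s \<inter> space M))"
proof -
  define S where "S = {v \<in> space (PiM {1::nat..} (\<lambda>_. borel::real measure)). \<forall>s\<in>J. v s \<in> C s}"
  have "Measurable.pred (PiM {1::nat..} (\<lambda>_. borel::real measure)) (\<lambda>v. \<forall>s\<in>J. v s \<in> C s)"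
  proof (rule pred_intros_countable_bounded(3))
    fix s assume "s \<in> J"
    then have "s \<in> {1..}" using assms by auto
    then show "Measurable.pred (PiM {1::nat..} (\<lambda>_. borel::real measure)) (\<lambda>v. v s \<in> C s)"
      using assms(3) by (intro pred_sets2[OF assms(3)] measurable_component_singleton)
  qed
  then have "S \<in> sets (PiM {1..} (\<lambda>_. borel))" unfolding S_def by (rule predE)
  then have "noise_path w -` S \<inter> space M \<in> sets (vimage_algebra (space M) (noise_path w) (PiM {1..} (\<lambda>_. borel)))"
    by (rule in_vimage_algebra)
  also have "noise_path w -` S \<inter> space M = (\<Inter>s\<in>J. w s -` C s) \<inter> space M"
    using assms(1) unfolding S_def noise_path_def by (auto simp: space_PiM restrict_apply)
  finally show "(\<Inter>s\<in>J. w s -` C s) \<inter> space M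
     \<in> sets (vimage_algebra (space M) (noise_path w) (PiM {1..} (\<lambda>_. borel)))" .
  show "prob ((\<Inter>s\<in>J. w s -` C s) \<inter> space M) = (\<Prod>s\<in>J. prob (w s -` C s \<inter> space M))"
  proof (cases "J = {}")
    case True
    then show ?thesis by (simp add: prob_space)
  next
    case False
    have "(\<Inter>s\<in>J. w s -` C s) \<inter> space M = (\<Inter>s\<in>J. w s -` C s \<inter> space M)" using False by auto
    then show ?thesis using indep_varsD[OF indep_noise, of J C] assms False by simp
  qed
qed

lemma cylinders_events: "cylinders t \<subseteq> events"
proof
  fix a assume "a \<in> cylinders t"
  then obtain A C where a: "a = X -` A \<inter> space M \<inter> (\<Inter>s\<in>{1..t}. w s -` C s)"
     and *: "A \<in> sets N" "\<And>s. C s \<in> sets borel"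
    by (auto simp: cylinders_def)
  have "(\<Inter>s\<in>{1..t}. w s -` C s) \<inter> space M \<in> events"
    using noise_event(1)[of "{1..t}" C] * indep_setD_ev2[OF indep_initial] by auto
  moreover have "X -` A \<inter> space M \<in> events" using X_measurable * by auto
  moreover have "a = (X -` A \<inter> space M) \<inter> ((\<Inter>s\<in>{1..t}. w s -` C s) \<inter> space M)" using a by auto
  ultimately show "a \<in> events" by auto
qed

lemma subalgebra_history: "subalgebra M (history t)"
  unfolding subalgebra_def sets_history using cylinders_events[of t]
  by (auto intro: sets.sigma_sets_subset[THEN subsetD])

lemma cylinders_mono: "s \<le> t \<Longrightarrow> cylinders s \<subseteq> cylinders t"
proof
  fix a assume st: "s \<le> t" and "a \<in> cylinders s"
  then obtain A C where a: "a = X -` A \<inter> space M \<inter> (\<Inter>r\<in>{1..s}. w r -` C r)"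
     and *: "A \<in> sets N" "\<And>r. C r \<in> sets borel"
    by (auto simp: cylinders_def)
  have "a = X -` A \<inter> space M \<inter> (\<Inter>r\<in>{1..t}. w r -` (if r \<le> s then C r else UNIV))"
    using a st by (auto split: if_splits)
  then show "a \<in> cylinders t" unfolding cylinders_def using *
    by (intro CollectI exI[of _ A] exI[of _ "\<lambda>r. if r \<le> s then C r else UNIV"]) auto
qed

lemma history_mono: "s \<le> t \<Longrightarrow> sets (history s) \<subseteq> sets (history t)"
  unfolding sets_history by (intro sigma_sets_mono' cylinders_mono)

lemma measurable_history_mono: "s \<le> t \<Longrightarrow> f \<in> measurable (history s) K \<Longrightarrow> f \<in> measurable (history t) K"
  using history_mono[of s t] by (auto simp: measurable_def)

lemma X_history: "X \<in> measurable (history t) N"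
proof (rule measurableI)
  fix A assume "A \<in> sets N"
  then have "X -` A \<inter> space M \<inter> (\<Inter>r\<in>{1..t}. w r -` UNIV) \<in> cylinders t"
    unfolding cylinders_def by (auto intro!: exI[of _ A] exI[of _ "\<lambda>_. UNIV"])
  then show "X -` A \<inter> space (history t) \<in> sets (history t)" by (auto simp: sets_history)
qed (use X_measurable[THEN measurable_space] in auto)

lemma w_history: "1 \<le> s \<Longrightarrow> s \<le> t \<Longrightarrow> w s \<in> borel_measurable (history t)"
proof (rule measurableI)
  fix C :: "real set" assume s: "1 \<le> s" "s \<le> t" and C: "C \<in> sets borel"
  have "X -` space N \<inter> space M \<inter> (\<Inter>r\<in>{1..t}. w r -` (if r = s then C else UNIV)) \<in> cylinders t"
    unfolding cylinders_def using C by (auto intro!: exI[of _ "space N"] exI[of _ "\<lambda>r. if r = s then C else UNIV"])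
  also have "X -` space N \<inter> space M \<inter> (\<Inter>r\<in>{1..t}. w r -` (if r = s then C else UNIV)) = w s -` C \<inter> space M"
    using s X_measurable[THEN measurable_space] by (auto split: if_splits)
  finally show "w s -` C \<inter> space (history t) \<in> sets (history t)" by (auto simp: sets_history)
qed auto

text \<open>It suffices to check intersection-stable generators. There \<open>indep_initial\<close>
  splits off the event of \<open>X\<close>, and the product formula for noise events, used on 1..t
  and on 1..t+1, splits off the last factor.\<close>

lemma indep_history:
  "indep_set (sets (history t)) (sigma_sets (space M) {w (Suc t) -` D \<inter> space M | D. D \<in> sets borel})"
  unfolding sets_history
proof (rule indep_set_sigma_sets)
  show "Int_stable (cylinders t)"
  proof (rule Int_stableI)
    fix a b assume "a \<in> cylinders t" "b \<in> cylinders t"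
    then obtain A C B D where a: "a = X -` A \<inter> space M \<inter> (\<Inter>r\<in>{1..t}. w r -` C r)"
      "b = X -` B \<inter> space M \<inter> (\<Inter>r\<in>{1..t}. w r -` D r)"
     and *: "A \<in> sets N" "\<And>r. C r \<in> sets borel" "B \<in> sets N" "\<And>r. D r \<in> sets borel"
      by (auto simp: cylinders_def)
    then have "a \<inter> b = X -` (A \<inter> B) \<inter> space M \<inter> (\<Inter>r\<in>{1..t}. w r -` (C r \<inter> D r))" by auto
    then show "a \<inter> b \<in> cylinders t" unfolding cylinders_def using *
      by (intro CollectI exI[of _ "A \<inter> B"] exI[of _ "\<lambda>r. C r \<inter> D r"]) auto
  qed
  show "Int_stable {w (Suc t) -` D \<inter> space M |D. D \<in> sets borel}"
    by (auto simp: Int_stable_def) (metis Int_assoc Int_left_commute sets.Int vimage_Int inf.idem)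
  show "indep_set (cylinders t) {w (Suc t) -` D \<inter> space M |D. D \<in> sets borel}"
  proof (rule indep_setI)
    show "cylinders t \<subseteq> events" by (rule cylinders_events)
    show "{w (Suc t) -` D \<inter> space M |D. D \<in> sets borel} \<subseteq> events" using w_measurable[of "Suc t"] by auto
    fix a b assume "a \<in> cylinders t" "b \<in> {w (Suc t) -` D \<inter> space M |D. D \<in> sets borel}"
    then obtain A C D where a: "a = X -` A \<inter> space M \<inter> (\<Inter>s\<in>{1..t}. w s -` C s)"
       and b: "b = w (Suc t) -` D \<inter> space M" and *: "A \<in> sets N" "\<And>s. C s \<in> sets borel" "D \<in> sets borel"
      by (auto simp: cylinders_def)
    define W where "W = (\<Inter>s\<in>{1..t}. w s -` C s) \<inter> space M"
    \<comment> \<open>Storing \<open>D\<close> as the constraint at time t + 1 makes the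
      intersection with \<open>b\<close> a cylinder of the same shape.\<close>
    define C' where "C' = C(Suc t := D)"
    define W' where "W' = (\<Inter>s\<in>{1..Suc t}. w s -` C' s) \<inter> space M"
    have C': "\<And>s. C' s \<in> sets borel" using * by (auto simp: C'_def)
    have XA: "X -` A \<inter> space M \<in> sets (vimage_algebra (space M) X N)"
      using * by (intro in_vimage_algebra)
    have a': "a = (X -` A \<inter> space M) \<inter> W" by (auto simp: a W_def)
    have "a \<inter> b = (X -` A \<inter> space M) \<inter> W'"
      by (auto simp: a b W'_def C'_def atLeastAtMostSuc_conv)
    then have "prob (a \<inter> b) = prob (X -` A \<inter> space M) * prob W'"
      using noise_event(1)[of "{1..Suc t}" C'] C' XA
      by (auto simp: W'_def intro: indep_setD[OF indep_initial])
    also have "prob W' = (\<Prod>s\<in>{1..Suc t}. prob (w s -` C' s \<inter> space M))"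
      unfolding W'_def by (rule noise_event) (use C' in auto)
    also have "\<dots> = (\<Prod>s\<in>{1..t}. prob (w s -` C s \<inter> space M)) * prob b"
      by (simp add: C'_def b prod.nat_ivl_Suc')
    also have "(\<Prod>s\<in>{1..t}. prob (w s -` C s \<inter> space M)) = prob W"
      unfolding W_def by (rule noise_event(2)[symmetric]) (use * in auto)
    also have "prob (X -` A \<inter> space M) * (prob W * prob b) = prob a * prob b"
      using noise_event(1)[of "{1..t}" C] * XA
      by (simp add: a' W_def indep_setD[OF indep_initial])
    finally show "prob (a \<inter> b) = prob a * prob b" .
  qed
qed

text \<open>Independence in the form needed for Tonelli's theorem; \<open>V\<close> will be a pair
  consisting of a weight and the predictable part of the next output.\<close>

lemma distr_history_noise:
  assumes V: "V \<in> measurable (history t) K"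
  shows "distr M K V \<Otimes>\<^sub>M distr M borel (w (Suc t)) = distr M (K \<Otimes>\<^sub>M borel) (\<lambda>\<omega>. (V \<omega>, w (Suc t) \<omega>))"
proof (rule pair_measure_eqI)
  have [measurable]: "V \<in> measurable M K" "w (Suc t) \<in> borel_measurable M"
    using measurable_from_subalg[OF subalgebra_history V] w_measurable[of "Suc t"] by auto
  interpret V: prob_space "distr M K V" by (rule prob_space_distr) measurable
  interpret W: prob_space "distr M borel (w (Suc t))" by (rule prob_space_distr) measurable
  show "sigma_finite_measure (distr M K V)" "sigma_finite_measure (distr M borel (w (Suc t)))" ..
  fix A B assume "A \<in> sets (distr M K V)" "B \<in> sets (distr M borel (w (Suc t)))"
  then have [measurable]: "A \<in> sets K" "B \<in> sets borel" by auto
  have "prob ((V -` A \<inter> space M) \<inter> (w (Suc t) -` B \<inter> space M)) = prob (V -` A \<inter> space M) * prob (w (Suc t) -` B \<inter> space M)"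
    using measurable_sets[OF V \<open>A \<in> sets K\<close>] \<open>B \<in> sets borel\<close> by (intro indep_setD[OF indep_history] sigma_sets.Basic) auto
  moreover have "(\<lambda>\<omega>. (V \<omega>, w (Suc t) \<omega>)) -` (A \<times> B) \<inter> space M = (V -` A \<inter> space M) \<inter> (w (Suc t) -` B \<inter> space M)" by auto
  ultimately show "emeasure (distr M K V) A * emeasure (distr M borel (w (Suc t))) B =
       emeasure (distr M (K \<Otimes>\<^sub>M borel) (\<lambda>\<omega>. (V \<omega>, w (Suc t) \<omega>))) (A \<times> B)"
    by (simp add: emeasure_distr emeasure_eq_measure ennreal_mult)
qed simp

text \<open>Conditioning by Tonelli: with the weight \<open>Z\<close> on \<open>A\<close> and the
  shift \<open>u\<close> frozen, the inner integral over the fresh noise is the Gaussian mass of a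
  shifted interval, at least \<open>c\<close> when \<open>u\<close> is within \<open>L\<close>. Off
  \<open>A\<close> the weight vanishes, so \<open>u\<close> has to be controlled only on
  \<open>A\<close>.\<close>

lemma expectation_next_output_ge:
  fixes a b L c :: real
  assumes u: "u \<in> borel_measurable (history t)" and A: "A \<in> sets (history t)"
    and Z: "Z \<in> borel_measurable (history t)" "\<And>\<omega>. 0 \<le> Z \<omega>" "\<And>\<omega>. Z \<omega> \<le> K"
    and L: "\<And>\<omega>. \<omega> \<in> A \<Longrightarrow> \<bar>u \<omega>\<bar> \<le> L"
    and c: "0 \<le> c" "\<And>v. \<bar>v\<bar> \<le> L \<Longrightarrow> ennreal c \<le> emeasure (density lborel std_normal_density) {x. a < v + x \<and> v + x < b}"
  shows "c * (\<integral>\<omega>. Z \<omega> * indicator A \<omega> \<partial>M)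
    \<le> (\<integral>\<omega>. Z \<omega> * indicator (A \<inter> {\<omega> \<in> space M. a < u \<omega> + w (Suc t) \<omega> \<and> u \<omega> + w (Suc t) \<omega> < b}) \<omega> \<partial>M)"
    (is "_ * integral\<^sup>L M ?f \<le> integral\<^sup>L M ?g")
proof -
  note [measurable] = u A Z(1)
  let ?V = "\<lambda>\<omega>. (Z \<omega> * indicator A \<omega>, u \<omega>) :: real \<times> real"
  let ?W = "w (Suc t)"
  let ?G = "density lborel std_normal_density :: real measure"
  have V: "?V \<in> measurable (history t) (borel \<Otimes>\<^sub>M borel)" by measurable
  then have [measurable]: "?V \<in> measurable M (borel \<Otimes>\<^sub>M borel)"
    by (rule measurable_from_subalg[OF subalgebra_history])
  have [measurable]: "Z \<in> borel_measurable M" "u \<in> borel_measurable M" "?W \<in> borel_measurable M" "A \<in> events"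
    using measurable_from_subalg[OF subalgebra_history Z(1)] measurable_from_subalg[OF subalgebra_history u]
      A w_measurable[of "Suc t"] subalgebra_history[of t]
    by (auto simp: subalgebra_def)
  have dW: "distr M borel ?W = ?G" by (rule std_normal) simp
  interpret G: prob_space ?G unfolding dW[symmetric] by (rule prob_space_distr) measurable
  have eq: "distr M (borel \<Otimes>\<^sub>M borel) ?V \<Otimes>\<^sub>M ?G = distr M ((borel \<Otimes>\<^sub>M borel) \<Otimes>\<^sub>M borel) (\<lambda>\<omega>. (?V \<omega>, ?W \<omega>))"
    using distr_history_noise[OF V] unfolding dW .
  let ?h = "\<lambda>((z, v), x). ennreal z * indicator {x. a < v + x \<and> v + x < b} (x::real)"
  have hm: "?h \<in> borel_measurable ((borel \<Otimes>\<^sub>M borel) \<Otimes>\<^sub>M borel)"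
  proof -
    have "?h = (\<lambda>p. ennreal (fst (fst p)) * indicator {p. a < snd (fst p) + snd p \<and> snd (fst p) + snd p < b} p)"
      by (auto simp: fun_eq_iff indicator_def)
    also have "\<dots> \<in> borel_measurable ((borel \<Otimes>\<^sub>M borel) \<Otimes>\<^sub>M borel)"
      by measurable
    finally show ?thesis .
  qed
  have K: "K \<ge> 0" using Z order_trans by blast
  have int: "integrable M ?f" "integrable M ?g"
    by (rule integrable_const_bound[where B=K]; use Z K in \<open>auto simp: indicator_def\<close>)+
  have nn: "0 \<le> integral\<^sup>L M ?g" using Z by (intro integral_nonneg_AE) auto
  have nnf: "0 \<le> integral\<^sup>L M ?f" using Z by (intro integral_nonneg_AE) auto
  have "ennreal (c * integral\<^sup>L M ?f) = ennreal c * (\<integral>\<^sup>+\<omega>. ennreal (?f \<omega>) \<partial>M)"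
    using c nnf Z by (subst nn_integral_eq_integral[OF int(1)]) (simp_all only: ennreal_mult, auto)
  also have "\<dots> = (\<integral>\<^sup>+\<omega>. ennreal (?f \<omega>) * ennreal c \<partial>M)"
    by (subst nn_integral_multc) (auto simp: mult.commute)
  also have "\<dots> \<le> (\<integral>\<^sup>+\<omega>. ennreal (?f \<omega>) * emeasure ?G {x. a < u \<omega> + x \<and> u \<omega> + x < b} \<partial>M)"
  proof (rule nn_integral_mono)
    fix \<omega>
    show "ennreal (?f \<omega>) * ennreal c \<le> ennreal (?f \<omega>) * emeasure ?G {x. a < u \<omega> + x \<and> u \<omega> + x < b}"
      using c(2)[OF L, of \<omega>] by (cases "\<omega> \<in> A") (auto intro: mult_left_mono)
  qed
  also have "\<dots> = (\<integral>\<^sup>+\<omega>. (\<integral>\<^sup>+x. ?h (?V \<omega>, x) \<partial>?G) \<partial>M)"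
    by (intro nn_integral_cong) (simp add: nn_integral_cmult_indicator)
  also have "\<dots> = (\<integral>\<^sup>+p. (\<integral>\<^sup>+x. ?h (p, x) \<partial>?G) \<partial>distr M (borel \<Otimes>\<^sub>M borel) ?V)"
    using hm by (subst nn_integral_distr) (auto intro!: G.borel_measurable_nn_integral)
  also have "\<dots> = (\<integral>\<^sup>+q. ?h q \<partial>(distr M (borel \<Otimes>\<^sub>M borel) ?V \<Otimes>\<^sub>M ?G))"
    using hm by (intro G.nn_integral_fst) (auto cong: measurable_cong_sets sets_pair_measure_cong)
  also have "\<dots> = (\<integral>\<^sup>+\<omega>. ?h (?V \<omega>, ?W \<omega>) \<partial>M)"
    unfolding eq using hm by (subst nn_integral_distr) auto
  also have "\<dots> = (\<integral>\<^sup>+\<omega>. ennreal (?g \<omega>) \<partial>M)"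
    by (intro nn_integral_cong) (auto simp: indicator_def)
  also have "\<dots> = ennreal (integral\<^sup>L M ?g)"
    using Z by (intro nn_integral_eq_integral int) auto
  finally show ?thesis using nn by (simp add: ennreal_le_iff)
qed

lemma AE_next_output_frequency:
  fixes a b L :: real
  assumes u: "\<And>t. u t \<in> borel_measurable (history t)" and A: "\<And>t. A t \<in> sets (history t)"
    and L: "\<And>t \<omega>. \<omega> \<in> A t \<Longrightarrow> \<bar>u t \<omega>\<bar> \<le> L" and ab: "a < b"
  shows "\<exists>e>0::real. AE \<omega> in M. (\<exists>\<^sub>\<infinity>t. \<omega> \<in> A t) \<longrightarrow>
     (\<forall>\<^sub>F t in sequentially. e * hits A t \<omega> \<le>
        hits (\<lambda>s. A s \<inter> {\<omega> \<in> space M. a < u s \<omega> + w (Suc s) \<omega> \<and> u s \<omega> + w (Suc s) \<omega> < b}) t \<omega>)"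
proof -
  obtain c where c: "0 < c" "c < 1"
    "\<And>u. \<bar>u\<bar> \<le> L \<Longrightarrow> ennreal c \<le> emeasure (density lborel std_normal_density) {x. a < u + x \<and> u + x < b}"
    using std_normal_interval_ge[OF ab] by blast
  interpret lower_bounded_trials M history A
    "\<lambda>s. {\<omega> \<in> space M. a < u s \<omega> + w (Suc s) \<omega> \<and> u s \<omega> + w (Suc s) \<omega> < b}" c
  proof unfold_locales
    fix t
    have [measurable]: "u t \<in> borel_measurable (history (Suc t))" "w (Suc t) \<in> borel_measurable (history (Suc t))"
      using measurable_history_mono[OF _ u, of t "Suc t"] w_history[of "Suc t" "Suc t"] by auto
    have "{\<omega> \<in> space (history (Suc t)). a < u t \<omega> + w (Suc t) \<omega> \<and> u t \<omega> + w (Suc t) \<omega> < b} \<in> sets (history (Suc t))"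
      by measurable
    then show "{\<omega> \<in> space M. a < u t \<omega> + w (Suc t) \<omega> \<and> u t \<omega> + w (Suc t) \<omega> < b} \<in> sets (history (Suc t))"
      by simp
  next
    fix t K and Z :: "'a \<Rightarrow> real"
    assume Z: "Z \<in> borel_measurable (history t)" "\<And>\<omega>. 0 \<le> Z \<omega>" "\<And>\<omega>. Z \<omega> \<le> K"
    show "c * (\<integral>\<omega>. Z \<omega> * indicator (A t) \<omega> \<partial>M)
    \<le> (\<integral>\<omega>. Z \<omega> * indicator (A t \<inter> {\<omega> \<in> space M. a < u t \<omega> + w (Suc t) \<omega> \<and> u t \<omega> + w (Suc t) \<omega> < b}) \<omega> \<partial>M)"
      using c by (intro expectation_next_output_ge[OF u A Z L]) auto
  qed (use subalgebra_history history_mono A c in auto)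
  show ?thesis by (rule AE_successes_ge)
qed

end

section \<open>Hitting the coordinates of a target box one after another\<close>

context innovations
begin

text \<open>Induction on k: each window that has met its first k targets supplies a trial for the
  next one, and positive relative frequencies multiply. In \<open>bound\<close> the constant may
  depend on the path, whereas the one-step result needs a fixed level; trials are therefore
  truncated at each natural level \<open>L\<close>. Correspondingly \<open>e\<close> is chosen after
  the path.\<close>

theorem AE_target_frequency:
  fixes y :: "nat \<Rightarrow> 'a \<Rightarrow> real" and u :: "nat \<Rightarrow> 'a \<Rightarrow> real" and Q :: "nat \<Rightarrow> 'a set" and a b :: "nat \<Rightarrow> real"
  assumes y: "\<And>t. y t \<in> borel_measurable (history t)" and u: "\<And>t. u t \<in> borel_measurable (history t)"
    and Q: "\<And>t. Q t \<in> sets (history t)"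
    and step: "\<And>t \<omega>. \<omega> \<in> space M \<Longrightarrow> y (Suc t) \<omega> = u t \<omega> + w (Suc t) \<omega>"
    and ab: "\<And>j. a j < b j"
    and bound: "\<And>k \<omega>. \<omega> \<in> space M \<Longrightarrow>
      \<exists>L. \<forall>t. \<omega> \<in> Q t \<longrightarrow> (\<forall>j<k. y (t + 1 + j) \<omega> \<in> {a j<..<b j}) \<longrightarrow> \<bar>u (t + k) \<omega>\<bar> \<le> L"
  shows "AE \<omega> in M. (\<exists>\<^sub>\<infinity>t. \<omega> \<in> Q t) \<longrightarrow> (\<exists>e>0::real. \<forall>\<^sub>F T in sequentially.
    e * hits Q T \<omega> \<le> hits (\<lambda>t. {\<omega> \<in> Q t. \<forall>j<k. y (t + 1 + j) \<omega> \<in> {a j<..<b j}}) T \<omega>)"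
proof -
  define R where "R k t = {\<omega> \<in> Q t. \<forall>j<k. y (t + 1 + j) \<omega> \<in> {a j<..<b j}}" for k t
  have Qspace: "Q t \<subseteq> space M" for t using sets.sets_into_space[OF Q[of t]] by simp
  have R: "R k t \<in> sets (history s)" if "t + k \<le> s" for k t s
  proof -
    have m[measurable]: "Q t \<in> sets (history s)" using history_mono[of t s] that Q[of t] by auto
    have "Measurable.pred (history s) (\<lambda>\<omega>. \<forall>j\<in>{..<k}. y (t + 1 + j) \<omega> \<in> {a j<..<b j})"
    proof (rule pred_intros_countable_bounded(3))
      fix j assume "j \<in> {..<k}"
      then have [measurable]: "y (t + 1 + j) \<in> borel_measurable (history s)"
        using that by (intro measurable_history_mono[OF _ y]) auto
      show "Measurable.pred (history s) (\<lambda>\<omega>. y (t + 1 + j) \<omega> \<in> {a j<..<b j})" by measurable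
    qed
    then have "{\<omega> \<in> space (history s). \<forall>j\<in>{..<k}. y (t + 1 + j) \<omega> \<in> {a j<..<b j}} \<in> sets (history s)" by (rule predE)
    moreover have "R k t = Q t \<inter> {\<omega> \<in> space (history s). \<forall>j\<in>{..<k}. y (t + 1 + j) \<omega> \<in> {a j<..<b j}}"
      using Qspace by (auto simp: R_def)
    ultimately show ?thesis using m by auto
  qed
  have "AE \<omega> in M. (\<exists>\<^sub>\<infinity>t. \<omega> \<in> Q t) \<longrightarrow> (\<exists>e>0::real. \<forall>\<^sub>F T in sequentially. e * hits Q T \<omega> \<le> hits (R k) T \<omega>)"
  proof (induction k)
    case 0
    show ?case by (intro always_eventually allI impI exI[of _ "1::real"]) (simp add: R_def hits_def)
  next
    case (Suc k)
    \<comment> \<open>Indexed by the time s = t + k of the trial. For s < k there is no window, and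
      natural subtraction would return the one at 0; hence the empty set.\<close>
    define A where "A L s = (if s < k then {} else R k (s - k) \<inter> {\<omega> \<in> space M. \<bar>u s \<omega>\<bar> \<le> real L})" for L s
    let ?B = "\<lambda>s. {\<omega> \<in> space M. a k < u s \<omega> + w (Suc s) \<omega> \<and> u s \<omega> + w (Suc s) \<omega> < b k}"
    have AS: "A L s \<in> sets (history s)" for L s
    proof -
      note u[measurable]
      have "{\<omega> \<in> space (history s). \<bar>u s \<omega>\<bar> \<le> real L} \<in> sets (history s)" by measurable
      then show ?thesis using R[of "s - k" k s] by (auto simp: A_def)
    qed
    have "\<forall>L. \<exists>e>0::real. AE \<omega> in M. (\<exists>\<^sub>\<infinity>s. \<omega> \<in> A L s) \<longrightarrow>
       (\<forall>\<^sub>F T in sequentially. e * hits (A L) T \<omega> \<le> hits (\<lambda>s. A L s \<inter> ?B s) T \<omega>)"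
    proof
      fix L
      show "\<exists>e>0::real. AE \<omega> in M. (\<exists>\<^sub>\<infinity>s. \<omega> \<in> A L s) \<longrightarrow>
         (\<forall>\<^sub>F T in sequentially. e * hits (A L) T \<omega> \<le> hits (\<lambda>s. A L s \<inter> ?B s) T \<omega>)"
        by (rule AE_next_output_frequency[OF u AS _ ab, where L="real L"]) (auto simp: A_def split: if_splits)
    qed
    from choice[OF this] obtain e where e: "\<And>L. e L > (0::real)" and
      AE: "\<And>L. AE \<omega> in M. (\<exists>\<^sub>\<infinity>s. \<omega> \<in> A L s) \<longrightarrow>
       (\<forall>\<^sub>F T in sequentially. e L * hits (A L) T \<omega> \<le> hits (\<lambda>s. A L s \<inter> ?B s) T \<omega>)"
      by auto
    \<comment> \<open>The levels are natural numbers so that one null set serves all of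
      them.\<close>
    have AE': "AE \<omega> in M. \<forall>L. (\<exists>\<^sub>\<infinity>s. \<omega> \<in> A L s) \<longrightarrow>
       (\<forall>\<^sub>F T in sequentially. e L * hits (A L) T \<omega> \<le> hits (\<lambda>s. A L s \<inter> ?B s) T \<omega>)"
      using AE by (simp add: AE_all_countable)
    from Suc AE' AE_space show ?case
    proof (eventually_elim, intro impI)
      fix \<omega>
      assume IH: "(\<exists>\<^sub>\<infinity>t. \<omega> \<in> Q t) \<longrightarrow> (\<exists>e>0::real. \<forall>\<^sub>F T in sequentially. e * hits Q T \<omega> \<le> hits (R k) T \<omega>)"
        and inf: "\<exists>\<^sub>\<infinity>t. \<omega> \<in> Q t" and sp: "\<omega> \<in> space M"
        and nxt: "\<forall>L. (\<exists>\<^sub>\<infinity>s. \<omega> \<in> A L s) \<longrightarrow>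
           (\<forall>\<^sub>F T in sequentially. e L * hits (A L) T \<omega> \<le> hits (\<lambda>s. A L s \<inter> ?B s) T \<omega>)"
      from IH inf obtain d :: real where d: "d > 0" and ev: "\<forall>\<^sub>F T in sequentially. d * hits Q T \<omega> \<le> hits (R k) T \<omega>" by blast
      from bound[OF sp, of k] obtain L' where
        L': "\<And>t. \<omega> \<in> Q t \<Longrightarrow> (\<forall>j<k. y (t + 1 + j) \<omega> \<in> {a j<..<b j}) \<Longrightarrow> \<bar>u (t + k) \<omega>\<bar> \<le> L'" by blast
      obtain L :: nat where "L' \<le> real L" using real_arch_simple by blast
      \<comment> \<open>On this path the truncation at level \<open>L\<close> removes
        nothing.\<close>
      then have mem: "\<omega> \<in> A L (t + k) \<longleftrightarrow> \<omega> \<in> R k t" for t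
        using L'[of t] sp by (auto simp: A_def R_def)
      have memS: "\<omega> \<in> A L (t + k) \<inter> ?B (t + k) \<longleftrightarrow> \<omega> \<in> R (Suc k) t" for t
      proof -
        have "y (t + 1 + k) \<omega> = u (t + k) \<omega> + w (Suc (t + k)) \<omega>" using step[OF sp, of "t + k"] by (simp add: add.commute)
        then show ?thesis unfolding Int_iff mem using sp by (auto simp: R_def less_Suc_eq)
      qed
      have h1: "hits (A L) (T + k) \<omega> = hits (R k) T \<omega>" for T
        by (rule hits_shift) (use mem in \<open>auto simp: A_def\<close>)
      have h2: "hits (\<lambda>s. A L s \<inter> ?B s) (T + k) \<omega> = hits (R (Suc k)) T \<omega>" for T
        by (rule hits_shift, simp add: A_def, rule memS)
      \<comment> \<open>Trials at this level recur: up to the shift by k they are the windows that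
        met their first k targets, which have positive frequency among infinitely many visits to
        \<open>Q\<close>.\<close>
      have "\<exists>\<^sub>\<infinity>s. \<omega> \<in> A L s"
        unfolding frequently_iff_hits_unbounded
      proof
        fix q
        from ev obtain T0 where T0: "\<And>T. T \<ge> T0 \<Longrightarrow> d * hits Q T \<omega> \<le> hits (R k) T \<omega>"
          by (auto simp: eventually_sequentially)
        obtain r :: nat where r: "real q / d \<le> real r" using real_arch_simple by blast
        obtain T where T: "r \<le> hits Q T \<omega>" using inf unfolding frequently_iff_hits_unbounded by blast
        define T' where "T' = max T T0"
        have "r \<le> hits Q T' \<omega>" using T hits_mono[of T T' Q \<omega>] by (simp add: T'_def)
        then have "real q / d \<le> hits Q T' \<omega>" using r by linarith
        then have "real q \<le> d * hits Q T' \<omega>" using d by (simp add: field_simps)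
        also have "\<dots> \<le> hits (R k) T' \<omega>" by (rule T0) (simp add: T'_def)
        finally have "q \<le> hits (A L) (T' + k) \<omega>" by (simp add: h1)
        then show "\<exists>t. q \<le> hits (A L) t \<omega>" ..
      qed
      with nxt have "\<forall>\<^sub>F T in sequentially. e L * hits (A L) T \<omega> \<le> hits (\<lambda>s. A L s \<inter> ?B s) T \<omega>" by blast
      then have "\<forall>\<^sub>F T in sequentially. e L * hits (A L) (T + k) \<omega> \<le> hits (\<lambda>s. A L s \<inter> ?B s) (T + k) \<omega>"
        unfolding eventually_sequentially by (meson trans_le_add1)
      with ev have "\<forall>\<^sub>F T in sequentially. (e L * d) * hits Q T \<omega> \<le> hits (R (Suc k)) T \<omega>"
      proof eventually_elim
        case (elim T)
        have "(e L * d) * hits Q T \<omega> \<le> e L * hits (R k) T \<omega>"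
          using mult_left_mono[OF elim(1), of "e L"] e[of L] by (simp add: mult.assoc)
        also have "\<dots> \<le> hits (R (Suc k)) T \<omega>" using elim(2) unfolding h1 h2 .
        finally show ?case .
      qed
      then show "\<exists>e>0::real. \<forall>\<^sub>F T in sequentially. e * hits Q T \<omega> \<le> hits (R (Suc k)) T \<omega>"
        using d e[of L] by (intro exI[of _ "e L * d"]) auto
    qed
  qed
  then show ?thesis by (simp add: R_def[abs_def])
qed

end

section \<open>Compactness of the unit sphere and target boxes\<close>

lemma compact_PiE_UNIV:
  fixes K :: "'i \<Rightarrow> 'b::topological_space set"
  assumes "\<And>i. compact (K i)"
  shows "compact (PiE UNIV K)"
proof -
  have "compactin (product_topology (\<lambda>i. euclidean) UNIV) (PiE UNIV K)"
    using assms by (simp add: compactin_PiE)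
  then show ?thesis by (simp add: euclidean_product_topology)
qed

text \<open>The dimension \<open>m\<close> is a term, not a type, so the unit sphere is modelled by
  functions vanishing from \<open>m\<close> on. It is closed in a product of compact intervals,
  compact by Tychonoff's theorem.\<close>

lemma compact_finite_support_sphere:
  "compact {x :: nat \<Rightarrow> real. (\<forall>i\<ge>m. x i = 0) \<and> (\<Sum>i<m. (x i)\<^sup>2) = 1}" (is "compact ?S")
proof -
  let ?K = "PiE UNIV (\<lambda>i. if i < m then {-1..1} else {0}) :: (nat \<Rightarrow> real) set"
  have 1: "compact ?K" by (rule compact_PiE_UNIV) auto
  have 2: "closed {x :: nat \<Rightarrow> real. (\<Sum>i<m. (x i)\<^sup>2) = 1}"
    by (intro closed_Collect_eq continuous_intros continuous_on_product_coordinates)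
  have "?S = ?K \<inter> {x. (\<Sum>i<m. (x i)\<^sup>2) = 1}"
  proof (intro Set.set_eqI iffI)
    fix x :: "nat \<Rightarrow> real" assume "x \<in> ?S"
    then have x: "\<forall>i\<ge>m. x i = 0" "(\<Sum>i<m. (x i)\<^sup>2) = 1" by auto
    have "x \<in> ?K"
    proof (rule PiE_I)
      fix i
      show "x i \<in> (if i < m then {-1..1} else {0})"
      proof (cases "i < m")
        case True
        then have "(x i)\<^sup>2 \<le> (\<Sum>i<m. (x i)\<^sup>2)" by (intro member_le_sum) auto
        then have "(x i)\<^sup>2 \<le> 1\<^sup>2" using x by simp
        then have "\<bar>x i\<bar> \<le> 1" by (subst (asm) abs_le_square_iff[symmetric]) simp
        then show ?thesis using True by auto
      qed (use x in auto)
    qed auto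
    then show "x \<in> ?K \<inter> {x. (\<Sum>i<m. (x i)\<^sup>2) = 1}" using x by blast
  next
    fix x :: "nat \<Rightarrow> real" assume x: "x \<in> ?K \<inter> {x. (\<Sum>i<m. (x i)\<^sup>2) = 1}"
    have "x i = 0" if "m \<le> i" for i
      using PiE_mem[of x UNIV "\<lambda>i. if i < m then {-1..1} else {0}" i] x that by auto
    then show "x \<in> ?S" using x by auto
  qed
  then show ?thesis using compact_Int_closed[OF 1 2] by simp
qed

text \<open>Around a point \<open>y\<close> where the linear form of x is nonzero, moving z within a
  small box changes the form by little, uniformly over the sphere, while moving x slightly keeps its
  value at \<open>y\<close> large. A finite subcover of the sphere then leaves finitely many boxes
  and one \<open>\<delta>\<close>.\<close>

lemma separable_features_boxes:
  fixes g :: "nat \<Rightarrow> real \<Rightarrow> real" and \<iota> :: "nat \<Rightarrow> nat"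
  assumes cont: "\<And>p. p < m \<Longrightarrow> continuous_on UNIV (g p)"
    and \<iota>: "\<And>p. p < m \<Longrightarrow> \<iota> p < n"
    and nondeg: "\<And>x. (\<Sum>p<m. (x p)\<^sup>2) = 1 \<Longrightarrow> \<exists>y. (\<Sum>p<m. g p (y (\<iota> p)) * x p) \<noteq> 0"
  shows "\<exists>(B :: ((nat \<Rightarrow> real) \<times> real) set) \<delta>. finite B \<and> 0 < \<delta> \<and> (\<forall>c\<in>B. 0 < snd c) \<and>
    (\<forall>x. (\<Sum>p<m. (x p)\<^sup>2) = 1 \<longrightarrow> (\<exists>c\<in>B. \<forall>z.
       (\<forall>k<n. \<bar>z k - fst c k\<bar> < snd c) \<longrightarrow> \<delta> \<le> \<bar>\<Sum>p<m. g p (z (\<iota> p)) * x p\<bar>))"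
proof -
  let ?S = "{x :: nat \<Rightarrow> real. (\<forall>i\<ge>m. x i = 0) \<and> (\<Sum>i<m. (x i)\<^sup>2) = 1}"
  let ?\<Psi> = "\<lambda>z x. \<Sum>p<m. g p (z (\<iota> p)) * x p :: real"
  have coord_le: "\<bar>x p\<bar> \<le> 1" if "x \<in> ?S" "p < m" for x p
  proof -
    have "(x p)\<^sup>2 \<le> (\<Sum>i<m. (x i)\<^sup>2)" using that by (intro member_le_sum) auto
    then have "(x p)\<^sup>2 \<le> 1\<^sup>2" using that by simp
    then show ?thesis by (subst (asm) abs_le_square_iff[symmetric]) simp
  qed
  have box: "\<exists>h>0. \<forall>z x. (\<forall>k<n. \<bar>z k - y k\<bar> < h) \<longrightarrow> x \<in> ?S \<longrightarrow> \<bar>?\<Psi> z x - ?\<Psi> y x\<bar> \<le> d"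
    if d: "d > 0" for d and y :: "nat \<Rightarrow> real"
  proof -
    \<comment> \<open>There are m error terms; dividing by m + 1 bounds their sum by d and is safe
      for m = 0.\<close>
    define d' where "d' = d / (m + 1)"
    have d': "d' > 0" using d by (simp add: d'_def)
    have "\<exists>h>0. \<forall>s. \<bar>s - y (\<iota> p)\<bar> < h \<longrightarrow> \<bar>g p s - g p (y (\<iota> p))\<bar> < d'" if "p < m" for p
      using cont[OF that] d' unfolding continuous_on_iff dist_real_def by blast
    then obtain H where H: "\<And>p. p < m \<Longrightarrow> H p > 0"
      "\<And>p s. p < m \<Longrightarrow> \<bar>s - y (\<iota> p)\<bar> < H p \<Longrightarrow> \<bar>g p s - g p (y (\<iota> p))\<bar> < d'"
      by metis
    define h where "h = Min (insert 1 (H ` {..<m}))"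
    have h: "h > 0" using H by (auto simp: h_def)
    have hH: "h \<le> H p" if "p < m" for p using that by (auto simp: h_def)
    show ?thesis
    proof (intro exI[of _ h] conjI allI impI h)
      fix z x assume z: "\<forall>k<n. \<bar>z k - y k\<bar> < h" and x: "x \<in> ?S"
      have "\<bar>?\<Psi> z x - ?\<Psi> y x\<bar> = \<bar>\<Sum>p<m. (g p (z (\<iota> p)) - g p (y (\<iota> p))) * x p\<bar>"
        by (simp add: sum_subtractf left_diff_distrib)
      also have "\<dots> \<le> (\<Sum>p<m. \<bar>(g p (z (\<iota> p)) - g p (y (\<iota> p))) * x p\<bar>)" by (rule sum_abs)
      also have "\<dots> \<le> (\<Sum>p<m. d')"
      proof (rule sum_mono)
        fix p assume "p \<in> {..<m}"
        then have p: "p < m" by simp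
        have "\<bar>z (\<iota> p) - y (\<iota> p)\<bar> < H p" using z \<iota>[OF p] hH[OF p] by force
        then have "\<bar>g p (z (\<iota> p)) - g p (y (\<iota> p))\<bar> \<le> d'" using H(2)[OF p] less_imp_le by blast
        then show "\<bar>(g p (z (\<iota> p)) - g p (y (\<iota> p))) * x p\<bar> \<le> d'"
          using mult_mono[OF _ coord_le[OF x p], of _ d'] d' by (simp add: abs_mult)
      qed
      also have "\<dots> \<le> d" using d by (simp add: d'_def field_simps)
      finally show "\<bar>?\<Psi> z x - ?\<Psi> y x\<bar> \<le> d" .
    qed
  qed
  define good where "good y h d \<longleftrightarrow> (\<forall>z x. (\<forall>k<n. \<bar>z k - y k\<bar> < h) \<longrightarrow> x \<in> ?S \<longrightarrow> \<bar>?\<Psi> z x - ?\<Psi> y x\<bar> \<le> d)"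
    for y h d
  have "\<forall>x\<in>?S. \<exists>q. 0 < fst q \<and> 0 < fst (snd q) \<and> 2 * fst q < \<bar>?\<Psi> (snd (snd q)) x\<bar> \<and> good (snd (snd q)) (fst (snd q)) (fst q)"
  proof
    fix x assume "x \<in> ?S"
    then obtain y where y: "?\<Psi> y x \<noteq> 0" using nondeg[of x] by auto
    \<comment> \<open>A third suffices: the value at \<open>y\<close> stays above 2d for nearby x,
      and moving z within the box costs at most d, leaving more than d.\<close>
    define d where "d = \<bar>?\<Psi> y x\<bar> / 3"
    have d: "d > 0" "2 * d < \<bar>?\<Psi> y x\<bar>" using y by (auto simp: d_def)
    from box[OF d(1), of y] obtain h where "h > 0" "good y h d" unfolding good_def by (elim exE conjE)
    with d show "\<exists>q. 0 < fst q \<and> 0 < fst (snd q) \<and> 2 * fst q < \<bar>?\<Psi> (snd (snd q)) x\<bar> \<and> good (snd (snd q)) (fst (snd q)) (fst q)"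
      by (intro exI[of _ "(d, h, y)"]) simp
  qed
  from bchoice[OF this] obtain q where q: "\<forall>x\<in>?S. 0 < fst (q x) \<and> 0 < fst (snd (q x)) \<and>
      2 * fst (q x) < \<bar>?\<Psi> (snd (snd (q x))) x\<bar> \<and> good (snd (snd (q x))) (fst (snd (q x))) (fst (q x))" ..
  define d h Y where "d x = fst (q x)" and "h x = fst (snd (q x))" and "Y x = snd (snd (q x))" for x
  have Y: "0 < d x \<and> 0 < h x \<and> 2 * d x < \<bar>?\<Psi> (Y x) x\<bar> \<and> good (Y x) (h x) (d x)" if "x \<in> ?S" for x
    using q[rule_format, OF that] unfolding d_def h_def Y_def .
  define U where "U x = {x'. 2 * d x < \<bar>?\<Psi> (Y x) x'\<bar>}" for x
  have "open (U x)" for x unfolding U_def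
    by (intro open_Collect_less continuous_intros continuous_on_product_coordinates)
  moreover have "?S \<subseteq> (\<Union>x\<in>?S. U x)"
  proof
    fix x assume "x \<in> ?S"
    with Y[OF this] show "x \<in> (\<Union>x\<in>?S. U x)" unfolding U_def by (intro UN_I[of x]) simp_all
  qed
  ultimately obtain T where T: "T \<subseteq> ?S" "finite T" "?S \<subseteq> (\<Union>x\<in>T. U x)"
    by (rule compactE_image[OF compact_finite_support_sphere[of m]])
  define B where "B = (\<lambda>x. (Y x, h x)) ` T"
  \<comment> \<open>\<open>insert 1\<close> keeps \<open>Min\<close> meaningful should the subcover
    be empty.\<close>
  define \<delta> where "\<delta> = Min (insert 1 (d ` T))"
  have \<delta>d: "\<delta> \<le> d x" if "x \<in> T" for x using that T by (auto simp: \<delta>_def)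
  show ?thesis
  proof (intro exI[of _ B] exI[of _ \<delta>] conjI allI impI)
    show "finite B" using T by (simp add: B_def)
    have "d x > 0" "h x > 0" if "x \<in> T" for x using Y[of x] T(1) that by blast+
    then show "\<delta> > 0" "\<forall>c\<in>B. 0 < snd c" using T(2) by (auto simp: \<delta>_def B_def)
    fix x :: "nat \<Rightarrow> real" assume x: "(\<Sum>p<m. (x p)\<^sup>2) = 1"
    \<comment> \<open>The claim concerns arbitrary functions x, the compact sphere only those
      vanishing from \<open>m\<close> on; the values below \<open>m\<close> determine the
      form.\<close>
    define x' where "x' i = (if i < m then x i else 0)" for i
    have x': "x' \<in> ?S" using x by (simp add: x'_def)
    have eq: "?\<Psi> z x' = ?\<Psi> z x" for z by (simp add: x'_def)
    from subsetD[OF T(3) x'] obtain x0 where x0: "x0 \<in> T" "2 * d x0 < \<bar>?\<Psi> (Y x0) x'\<bar>"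
      unfolding U_def by (elim UN_E CollectE)
    have "\<delta> \<le> \<bar>?\<Psi> z x\<bar>" if "\<forall>k<n. \<bar>z k - Y x0 k\<bar> < h x0" for z
    proof -
      have "\<bar>?\<Psi> z x' - ?\<Psi> (Y x0) x'\<bar> \<le> d x0" using Y[of x0] x0(1) T(1) that x' unfolding good_def by blast
      then show ?thesis using x0 \<delta>d[OF x0(1)] unfolding eq by linarith
    qed
    then show "\<exists>c\<in>B. \<forall>z. (\<forall>k<n. \<bar>z k - fst c k\<bar> < snd c) \<longrightarrow> \<delta> \<le> \<bar>?\<Psi> z x\<bar>"
      unfolding B_def using x0(1) by (intro bexI[of _ "(Y x0, h x0)"]) simp_all
  qed
qed

section \<open>The information matrix\<close>

lemma dim_col_stack: "dim_vec (col_stack v n) = (\<Sum>i<n. dim_vec (v i))"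
  by (induction n) (auto)

lemma dim_phi [simp]: "dim_vec (phi n ms f z) = total_dim n ms"
  by (simp add: phi_def dim_col_stack phi_block_def total_dim_def)

text \<open>The pair (i, j) is found before z is given, so each component is one scalar function of
  one coordinate: the separable form required for the boxes.\<close>

lemma phi_component:
  assumes "p < total_dim n ms"
  shows "\<exists>i<n. \<exists>j<ms i. \<forall>z. phi n ms f z $ p = f i j (z $ i)"
  using assms
proof (induction n)
  case 0
  then show ?case by (simp add: total_dim_def)
next
  case (Suc n)
  have app: "phi (Suc n) ms f z = phi n ms f z @\<^sub>v phi_block ms f n (z $ n)" for z
    by (simp add: phi_def)
  show ?case
  proof (cases "p < total_dim n ms")
    case True
    then have "phi (Suc n) ms f z $ p = phi n ms f z $ p" for z
      by (simp add: app)
    with Suc.IH[OF True] show ?thesis by (metis less_SucI)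
  next
    case False
    then have *: "p - total_dim n ms < ms n" using Suc.prems by (auto simp: total_dim_def)
    then have "phi (Suc n) ms f z $ p = f n (p - total_dim n ms) (z $ n)" for z
      using False Suc.prems by (simp add: app phi_block_def total_dim_def)
    then show ?thesis using * by blast
  qed
qed

text \<open>Guarantees that \<open>min_eigenvalue\<close> is a \<open>Min\<close> over a nonempty
  set. A complex eigenvector a + ib exists; symmetry equates the bilinear form at (b, a) and (a, b),
  which forces the imaginary part of the eigenvalue to vanish. Then a or b, whichever is nonzero, is
  a real eigenvector.\<close>

lemma real_symmetric_spectrum_nonempty:
  fixes A :: "real mat"
  assumes A: "A \<in> carrier_mat m m" and m: "m > 0"
    and sym: "\<And>i j. i < m \<Longrightarrow> j < m \<Longrightarrow> A $$ (i, j) = A $$ (j, i)"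
  shows "spectrum A \<noteq> {}"
proof -
  define C where "C = map_mat complex_of_real A"
  have C: "C \<in> carrier_mat m m" using A by (simp add: C_def)
  from spectrum_non_empty[OF C m] obtain l where "eigenvalue C l" by (auto simp: spectrum_def)
  then obtain v where v: "v \<in> carrier_vec m" "v \<noteq> 0\<^sub>v m" "C *\<^sub>v v = l \<cdot>\<^sub>v v"
    using C by (auto simp: eigenvalue_def eigenvector_def)
  have row: "(\<Sum>j<m. complex_of_real (A $$ (i, j)) * v $ j) = l * v $ i" if "i < m" for i
  proof -
    have "(C *\<^sub>v v) $ i = l * v $ i" using v that by simp
    moreover have "(C *\<^sub>v v) $ i = (\<Sum>j<m. complex_of_real (A $$ (i, j)) * v $ j)" using that A v(1)
      by (simp add: C_def scalar_prod_def lessThan_atLeast0)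
    ultimately show ?thesis by simp
  qed
  define a where "a i = Re (v $ i)" for i
  define b where "b i = Im (v $ i)" for i
  have Aa: "(\<Sum>j<m. A $$ (i, j) * a j) = Re l * a i - Im l * b i" if "i < m" for i
    using arg_cong[OF row[OF that], of Re] by (simp add: a_def b_def)
  have Ab: "(\<Sum>j<m. A $$ (i, j) * b j) = Re l * b i + Im l * a i" if "i < m" for i
    using arg_cong[OF row[OF that], of Im] by (simp add: a_def b_def)
  have "(\<Sum>i<m. b i * (\<Sum>j<m. A $$ (i, j) * a j)) = (\<Sum>j<m. \<Sum>i<m. b i * (A $$ (i, j) * a j))"
    unfolding sum_distrib_left by (rule sum.swap)
  also have "\<dots> = (\<Sum>j<m. a j * (\<Sum>i<m. A $$ (j, i) * b i))"
    by (auto simp: sum_distrib_left sym intro!: sum.cong)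
  finally have "(\<Sum>i<m. b i * (Re l * a i - Im l * b i)) = (\<Sum>i<m. a i * (Re l * b i + Im l * a i))"
    by (simp add: Aa Ab)
  then have "(\<Sum>i<m. a i * (Re l * b i + Im l * a i) - b i * (Re l * a i - Im l * b i)) = 0"
    by (simp add: sum_subtractf)
  also have "(\<Sum>i<m. a i * (Re l * b i + Im l * a i) - b i * (Re l * a i - Im l * b i)) = Im l * (\<Sum>i<m. (a i)\<^sup>2 + (b i)\<^sup>2)"
    by (auto simp: sum_distrib_left algebra_simps power2_eq_square intro!: sum.cong)
  finally have z: "Im l * (\<Sum>i<m. (a i)\<^sup>2 + (b i)\<^sup>2) = 0" .
  obtain i where i: "i < m" "v $ i \<noteq> 0" using v(1,2) by (auto simp: vec_eq_iff)
  then have ab: "a i \<noteq> 0 \<or> b i \<noteq> 0" by (auto simp: a_def b_def complex_eq_iff)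
  then have "0 < (a i)\<^sup>2 + (b i)\<^sup>2" by (simp add: sum_power2_gt_zero_iff)
  also have "\<dots> \<le> (\<Sum>i<m. (a i)\<^sup>2 + (b i)\<^sup>2)" using i by (intro member_le_sum) auto
  finally have l: "Im l = 0" using z by auto
  have ev: "eigenvalue A (Re l)" if "\<And>i. i < m \<Longrightarrow> (\<Sum>j<m. A $$ (i, j) * c j) = Re l * c i" "c i \<noteq> 0" for c
  proof -
    have "eigenvector A (vec m c) (Re l)"
      unfolding eigenvector_def
    proof (intro conjI)
      show "vec m c \<in> carrier_vec (dim_row A)" using A by simp
      show "vec m c \<noteq> 0\<^sub>v (dim_row A)" using A i(1) that(2) by (auto simp: vec_eq_iff)
      show "A *\<^sub>v vec m c = Re l \<cdot>\<^sub>v vec m c"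
      proof (rule eq_vecI)
        fix j assume "j < dim_vec (Re l \<cdot>\<^sub>v vec m c)"
        then have j: "j < m" by simp
        then have "(A *\<^sub>v vec m c) $ j = (\<Sum>k<m. A $$ (j, k) * c k)"
          using A by (simp add: scalar_prod_def lessThan_atLeast0)
        then show "(A *\<^sub>v vec m c) $ j = (Re l \<cdot>\<^sub>v vec m c) $ j" using that(1)[OF j] j by simp
      qed (use A in simp)
    qed
    then show ?thesis by (auto simp: eigenvalue_def)
  qed
  have "eigenvalue A (Re l)" using ab ev[of a] ev[of b] Aa Ab l by auto
  then show ?thesis by (auto simp: spectrum_def)
qed

text \<open>Every eigenvalue is the Rayleigh quotient at its normalised eigenvector, so a lower
  bound on the sphere bounds the whole finite nonempty spectrum.\<close>

lemma min_eigenvalue_ge: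
  fixes A :: "real mat"
  assumes A: "A \<in> carrier_mat m m" and m: "m > 0"
    and sym: "\<And>i j. i < m \<Longrightarrow> j < m \<Longrightarrow> A $$ (i, j) = A $$ (j, i)"
    and ge: "\<And>x. (\<Sum>p<m. (x p)\<^sup>2) = 1 \<Longrightarrow> c \<le> (\<Sum>i<m. \<Sum>j<m. x i * A $$ (i, j) * x j)"
  shows "c \<le> min_eigenvalue A"
proof -
  have "c \<le> l" if "l \<in> spectrum A" for l
  proof -
    from that obtain v where v: "v \<in> carrier_vec m" "v \<noteq> 0\<^sub>v m" "A *\<^sub>v v = l \<cdot>\<^sub>v v"
      using A by (auto simp: eigenvalue_def eigenvector_def spectrum_def)
    have row: "(\<Sum>j<m. A $$ (i, j) * v $ j) = l * v $ i" if "i < m" for i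
    proof -
      have "(A *\<^sub>v v) $ i = l * v $ i" using v that by simp
      moreover have "(A *\<^sub>v v) $ i = (\<Sum>j<m. A $$ (i, j) * v $ j)" using that A v(1)
        by (simp add: scalar_prod_def lessThan_atLeast0)
      ultimately show ?thesis by simp
    qed
    define s where "s = (\<Sum>i<m. (v $ i)\<^sup>2)"
    obtain i where i: "i < m" "v $ i \<noteq> 0" using v(1,2) by (auto simp: vec_eq_iff)
    then have "0 < (v $ i)\<^sup>2" by simp
    also have "\<dots> \<le> s" unfolding s_def using i by (intro member_le_sum) auto
    finally have s: "s > 0" .
    define x where "x p = v $ p / sqrt s" for p
    have x1: "(\<Sum>p<m. (x p)\<^sup>2) = 1"
      using s by (simp add: x_def power_divide sum_divide_distrib[symmetric] s_def[symmetric])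
    have "(\<Sum>i<m. \<Sum>j<m. x i * A $$ (i, j) * x j) = (\<Sum>i<m. x i * (\<Sum>j<m. A $$ (i, j) * v $ j) / sqrt s)"
      by (simp add: x_def sum_distrib_left sum_divide_distrib mult.assoc)
    also have "\<dots> = (\<Sum>i<m. l * (x i)\<^sup>2)"
      by (intro sum.cong) (auto simp: row x_def power2_eq_square)
    also have "\<dots> = l" using x1 by (simp add: sum_distrib_left[symmetric])
    finally show ?thesis using ge[OF x1] by simp
  qed
  then show ?thesis unfolding min_eigenvalue_def
    using real_symmetric_spectrum_nonempty[OF A m sym] card_finite_spectrum(1)[OF A] by (subst Min_ge_iff) auto
qed

lemma info_matrix_quadratic_form:
  "(\<Sum>i<total_dim n ms. \<Sum>j<total_dim n ms. x i * info_matrix n ms f y t \<omega> $$ (i, j) * x j)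
   = (\<Sum>i<total_dim n ms. (x i)\<^sup>2) + (\<Sum>s\<le>t. (\<Sum>p<total_dim n ms. regressor n ms f y s \<omega> $ p * x p)\<^sup>2)"
proof -
  let ?m = "total_dim n ms"
  let ?r = "\<lambda>s p. regressor n ms f y s \<omega> $ p"
  have "(\<Sum>i<?m. \<Sum>j<?m. x i * info_matrix n ms f y t \<omega> $$ (i, j) * x j)
     = (\<Sum>i<?m. \<Sum>j<?m. (if i = j then x i * x j else 0) + (\<Sum>s\<le>t. (?r s i * x i) * (?r s j * x j)))"
    by (intro sum.cong) (auto simp: info_matrix_def algebra_simps sum_distrib_left atLeast0AtMost)
  also have "\<dots> = (\<Sum>i<?m. (x i)\<^sup>2) + (\<Sum>i<?m. \<Sum>j<?m. \<Sum>s\<le>t. (?r s i * x i) * (?r s j * x j))"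
    by (simp add: sum.distrib power2_eq_square)
  also have "(\<Sum>i<?m. \<Sum>j<?m. \<Sum>s\<le>t. (?r s i * x i) * (?r s j * x j)) = (\<Sum>s\<le>t. \<Sum>i<?m. \<Sum>j<?m. (?r s i * x i) * (?r s j * x j))"
    by (subst sum.swap[of _ "{..t}"], subst sum.swap[of _ "{..t}"]) simp
  also have "\<dots> = (\<Sum>s\<le>t. (\<Sum>p<?m. ?r s p * x p)\<^sup>2)"
    by (simp add: power2_eq_square sum_product)
  finally show ?thesis .
qed

lemma regressor_component:
  assumes "\<And>z. phi n ms f z $ p = g (z $ i)" "i < n"
  shows "regressor n ms f y t \<omega> $ p = g (y (int t - int i) \<omega>)"
  using assms by (simp add: regressor_def)

lemma vec_norm_eq: "vec_norm v = sqrt (\<Sum>k<dim_vec v. (v $ k)\<^sup>2)"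
  by (simp add: vec_norm_def scalar_prod_def power2_eq_square lessThan_atLeast0)

lemma abs_component_le_vec_norm: "k < dim_vec v \<Longrightarrow> \<bar>v $ k\<bar> \<le> vec_norm v"
  unfolding vec_norm_eq by (rule real_le_rsqrt) (auto intro!: member_le_sum)

text \<open>\<open>Y_vec\<close> at i is the lag window ending at time i + n - 1. The indices 1..t
  thus give windows ending at n..t+n-1, while \<open>hits\<close> also counts those ending before
  n.\<close>

lemma N_count_le_hits:
  assumes "n \<ge> 1" and "\<omega> \<in> S"
  shows "N_count n y M t \<omega> \<le> hits (\<lambda>t. {\<omega> \<in> S. vec_norm (vec n (\<lambda>k. y (int t - int k) \<omega>)) \<le> M}) (t + n) \<omega>"
proof (induction t)
  case 0
  then show ?case by (simp add: N_count_def)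
next
  case (Suc t)
  have "Y_vec n y (Suc t) \<omega> = vec n (\<lambda>k. y (int (t + n) - int k) \<omega>)"
    by (simp add: Y_vec_def algebra_simps)
  then show ?case using Suc assms(2) by (simp add: N_count_def hits_Suc indicator_def)
qed

theorem theorem2p1:
  fixes Pr :: "'a measure"
    and n :: nat and ms :: "nat \<Rightarrow> nat"
    and f :: "nat \<Rightarrow> nat \<Rightarrow> real \<Rightarrow> real"
    and \<theta> :: "'a \<Rightarrow> real vec" and \<theta>\<^sub>0 :: "real vec"
    and w :: "nat \<Rightarrow> 'a \<Rightarrow> real" and y :: "int \<Rightarrow> 'a \<Rightarrow> real"
    and M :: real
  assumes "prob_space Pr"
    and "n \<ge> 1" and "\<forall>i<n. ms i \<ge> 1"
    and "\<forall>i<n. \<forall>j<ms i. f i j \<in> borel_measurable lebesgue"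
    and "assumption_A1 Pr (total_dim n ms) w \<theta> \<theta>\<^sub>0"
    and "assumption_A2 n ms f"
    and "initial_data Pr (total_dim n ms) w \<theta> y"
    and "\<forall>t. \<forall>\<omega>\<in>space Pr.
           y (int t + 1) \<omega> = \<theta> \<omega> \<bullet> regressor n ms f y t \<omega> + w (t + 1) \<omega>"
    and "M > 0"
  shows "AE \<omega> in Pr. \<omega> \<in> Omega_set Pr n y M \<longrightarrow>
           0 < liminf (\<lambda>t. ereal (min_eigenvalue (info_matrix n ms f y t \<omega>) / N_count n y M t \<omega>))"
proof -
  define m where "m = total_dim n ms"
  define X where "X = (\<lambda>\<omega>. (coords m (\<theta> \<omega>), y 0 \<omega>))"
  define N where "N = (PiM {..<m} (\<lambda>_. borel) \<Otimes>\<^sub>M borel :: ((nat \<Rightarrow> real) \<times> real) measure)"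
  interpret prob_space Pr by fact
  have m: "m > 0"
  proof -
    have "1 \<le> ms 0" "ms 0 \<le> (\<Sum>i<n. ms i)" using assms(2,3) by (auto intro!: member_le_sum)
    then show ?thesis by (simp add: m_def total_dim_def)
  qed
  note A1 = assms(5)[unfolded assumption_A1_def, folded m_def]
  note init = assms(7)[unfolded initial_data_def, folded m_def]
  interpret innovations Pr X N w
  proof
    have "(\<lambda>\<omega>. coords m (\<theta> \<omega>)) \<in> measurable Pr (PiM {..<m} (\<lambda>_. lborel))"
      using A1 unfolding distributed_def by blast
    also have "measurable Pr (PiM {..<m} (\<lambda>_. lborel :: real measure)) = measurable Pr (PiM {..<m} (\<lambda>_. borel))"
      by (intro measurable_cong_sets sets_PiM_cong) auto
    finally have [measurable]: "(\<lambda>\<omega>. coords m (\<theta> \<omega>)) \<in> measurable Pr (PiM {..<m} (\<lambda>_. borel))" .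
    have [measurable]: "y 0 \<in> borel_measurable Pr" using init by blast
    show "X \<in> measurable Pr N" unfolding X_def N_def by measurable
    show "indep_vars (\<lambda>_. borel) w {1..}" using A1 by blast
    have "distr Pr lborel (w 1) = density lborel std_normal_density"
      using A1 unfolding distributed_def by blast
    moreover have "distr Pr lborel (w 1) = distr Pr borel (w 1)" by (intro distr_cong) auto
    ultimately show "distr Pr borel (w t) = density lborel std_normal_density" if "t \<ge> 1" for t
      using A1 that by metis
    show "indep_set (sets (vimage_algebra (space Pr) X N))
       (sets (vimage_algebra (space Pr) (noise_path w) (PiM {1..} (\<lambda>_. borel))))"
      using init unfolding X_def N_def by blast
  qed

  \<comment> \<open>Coordinate form of the regressor and adaptedness of the outputs\<close>
  from assms(6) obtain E where cont: "\<And>i j. i < n \<Longrightarrow> j < ms i \<Longrightarrow> continuous_on UNIV (f i j)"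
    and nondeg: "\<And>x. x \<in> carrier_vec m \<Longrightarrow> vec_norm x = 1 \<Longrightarrow>
             \<exists>z\<in>carrier_vec n. (\<forall>i<n. z $ i \<in> E i) \<and> \<bar>phi n ms f z \<bullet> x\<bar> \<noteq> 0"
    unfolding assumption_A2_def m_def by blast
  have "\<forall>p. \<exists>q. p < m \<longrightarrow> fst q < n \<and> snd q < ms (fst q) \<and> (\<forall>z. phi n ms f z $ p = f (fst q) (snd q) (z $ fst q))"
    using phi_component[of _ n ms f] by (fastforce simp: m_def)
  from choice[OF this] obtain q where
    q: "\<And>p. p < m \<Longrightarrow> fst (q p) < n" "\<And>p. p < m \<Longrightarrow> snd (q p) < ms (fst (q p))"
      "\<And>p z. p < m \<Longrightarrow> phi n ms f z $ p = f (fst (q p)) (snd (q p)) (z $ fst (q p))" by blast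
  define \<iota> where "\<iota> p = fst (q p)" for p
  define g where "g p = f (fst (q p)) (snd (q p))" for p
  have \<iota>: "\<iota> p < n" if "p < m" for p using q(1)[OF that] by (simp add: \<iota>_def)
  have g: "continuous_on UNIV (g p)" if "p < m" for p using cont[OF q(1)[OF that] q(2)[OF that]] by (simp add: g_def)
  have g_meas: "g p \<in> borel_measurable borel" if "p < m" for p
    using g[OF that] by (rule borel_measurable_continuous_onI)
  have phi: "phi n ms f z $ p = g p (z $ \<iota> p)" if "p < m" for p z using q(3)[OF that] by (simp add: g_def \<iota>_def)
  have reg: "regressor n ms f y t \<omega> $ p = g p (y (int t - int (\<iota> p)) \<omega>)" if "p < m" for p t \<omega>
    using phi[OF that] \<iota>[OF that] by (rule regressor_component)

  \<comment> \<open>The part of the next output already determined by \<open>\<theta>\<close> and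
    the past; the rest is fresh noise.\<close>
  define u where "u t \<omega> = (\<Sum>p<m. coords m (\<theta> \<omega>) p * g p (y (int t - int (\<iota> p)) \<omega>))" for t \<omega>
  have step: "y (int (Suc t)) \<omega> = u t \<omega> + w (Suc t) \<omega>" if "\<omega> \<in> space Pr" for t \<omega>
  proof -
    have "\<theta> \<omega> \<bullet> regressor n ms f y t \<omega> = (\<Sum>p<m. \<theta> \<omega> $ p * regressor n ms f y t \<omega> $ p)"
      by (simp add: scalar_prod_def regressor_def m_def lessThan_atLeast0)
    also have "\<dots> = u t \<omega>" unfolding u_def by (intro sum.cong) (auto simp: reg coords_def)
    finally show ?thesis using assms(8)[rule_format, OF that, of t] by (simp add: add.commute)
  qed
  have \<theta>_hist: "(\<lambda>\<omega>. coords m (\<theta> \<omega>) p) \<in> borel_measurable (history t)" if "p < m" for p t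
  proof -
    have "(\<lambda>x. fst x p) \<in> borel_measurable N"
      unfolding N_def using that by (intro measurable_compose[OF measurable_fst] measurable_component_singleton) auto
    from measurable_compose[OF X_history this] show ?thesis by (simp add: X_def)
  qed
  have y0: "y 0 \<in> borel_measurable (history t)" for t
  proof -
    have "snd \<in> borel_measurable N" unfolding N_def by measurable
    from measurable_compose[OF X_history this] show ?thesis by (simp add: X_def)
  qed
  have lag: "y (int t - int k) \<in> borel_measurable (history t)"
    if hyp: "\<And>s. s \<le> t \<Longrightarrow> y (int s) \<in> borel_measurable (history t)" for t k
  proof (cases "k \<le> t")
    case True
    then have "int t - int k = int (t - k)" by (simp add: of_nat_diff)
    then show ?thesis using hyp[OF diff_le_self] by (simp only:)
  next
    case False
    then have "y (int t - int k) \<omega> = 0" if "\<omega> \<in> space (history t)" for \<omega> using init that by simp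
    then show ?thesis by (subst measurable_cong[where g="\<lambda>_. 0"]) auto
  qed
  have u_of_y: "u t \<in> borel_measurable (history t)" if hyp: "\<And>s. s \<le> t \<Longrightarrow> y (int s) \<in> borel_measurable (history t)" for t
    unfolding u_def[abs_def]
  proof (intro borel_measurable_sum borel_measurable_times)
    fix p assume "p \<in> {..<m}"
    then have p: "p < m" by simp
    show "(\<lambda>\<omega>. coords m (\<theta> \<omega>) p) \<in> borel_measurable (history t)" by (rule \<theta>_hist[OF p])
    from lag[OF hyp] show "(\<lambda>\<omega>. g p (y (int t - int (\<iota> p)) \<omega>)) \<in> borel_measurable (history t)"
      by (rule measurable_compose[OF _ g_meas[OF p]])
  qed
  \<comment> \<open>Stated for all s up to t because the regressor at t reaches back over several
    outputs; lags before time 0 are zero.\<close>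
  have y_le: "\<forall>s\<le>t. y (int s) \<in> borel_measurable (history t)" for t
  proof (induction t)
    case 0
    then show ?case using y0 by simp
  next
    case (Suc t)
    have [measurable]: "u t \<in> borel_measurable (history (Suc t))" "w (Suc t) \<in> borel_measurable (history (Suc t))"
      using measurable_history_mono[OF _ u_of_y, of t "Suc t"] Suc w_history[of "Suc t" "Suc t"] by auto
    have "y (int (Suc t)) \<in> borel_measurable (history (Suc t))"
      by (subst measurable_cong[where g="\<lambda>\<omega>. u t \<omega> + w (Suc t) \<omega>"]) (use step in auto)
    then show ?case using Suc measurable_history_mono[of t "Suc t"] by (auto simp: le_Suc_eq)
  qed
  have u_hist: "u t \<in> borel_measurable (history t)" for t using u_of_y y_le by blast

  define Q where "Q t = {\<omega> \<in> space Pr. vec_norm (vec n (\<lambda>k. y (int t - int k) \<omega>)) \<le> M}" for t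
  have Q_hist: "Q t \<in> sets (history t)" for t
  proof -
    have [measurable]: "y (int t - int k) \<in> borel_measurable (history t)" for k
      using lag y_le by blast
    have "{\<omega> \<in> space (history t). sqrt (\<Sum>k<n. (y (int t - int k) \<omega>)\<^sup>2) \<le> M} \<in> sets (history t)"
      by measurable
    then show ?thesis by (simp add: Q_def vec_norm_eq)
  qed
  have bound: "\<exists>L. \<forall>t. \<omega> \<in> Q t \<longrightarrow> (\<forall>j<k. y (int (t + 1 + j)) \<omega> \<in> {a j<..<b j}) \<longrightarrow> \<bar>u (t + k) \<omega>\<bar> \<le> L"
    for a b :: "nat \<Rightarrow> real" and k \<omega>
  proof -
    \<comment> \<open>After k further steps the window mixes up to k outputs lying in their target
      intervals with older ones from the bounded window at t; \<open>R\<close> dominates both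
      kinds.\<close>
    define R where "R = M + (\<Sum>j<k. \<bar>a j\<bar> + \<bar>b j\<bar>)"
    have "\<forall>p. \<exists>G. p < m \<longrightarrow> (\<forall>s\<in>{-R..R}. \<bar>g p s\<bar> \<le> G)"
    proof
      fix p
      show "\<exists>G. p < m \<longrightarrow> (\<forall>s\<in>{-R..R}. \<bar>g p s\<bar> \<le> G)"
      proof (cases "p < m")
        case True
        have "compact (g p ` {-R..R})"
          by (intro compact_continuous_image continuous_on_subset[OF g[OF True]]) auto
        then have "bounded (g p ` {-R..R})" by (rule compact_imp_bounded)
        then show ?thesis unfolding bounded_iff by auto
      qed simp
    qed
    from choice[OF this] obtain G where G: "\<And>p s. p < m \<Longrightarrow> s \<in> {-R..R} \<Longrightarrow> \<bar>g p s\<bar> \<le> G p" by blast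
    show ?thesis
    \<comment> \<open>This level is uniform in t and depends on the path only through
      \<open>\<theta>\<close>.\<close>
    proof (intro exI[of _ "\<Sum>p<m. \<bar>coords m (\<theta> \<omega>) p\<bar> * G p"] allI impI)
      fix t assume Qt: "\<omega> \<in> Q t" and tgt: "\<forall>j<k. y (int (t + 1 + j)) \<omega> \<in> {a j<..<b j}"
      have R: "y (int (t + k) - int i) \<omega> \<in> {-R..R}" if i: "i < n" for i
      proof (cases "i < k")
        case True
        define j where "j = k - i - 1"
        have j: "j < k" "int (t + k) - int i = int (t + 1 + j)" using True by (auto simp: j_def)
        have "\<bar>a j\<bar> + \<bar>b j\<bar> \<le> (\<Sum>j<k. \<bar>a j\<bar> + \<bar>b j\<bar>)"
          using j(1) by (intro member_le_sum[where f="\<lambda>j. \<bar>a j\<bar> + \<bar>b j\<bar>"]) auto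
        moreover have "y (int (t + k) - int i) \<omega> \<in> {a j<..<b j}"
          using tgt[rule_format, OF j(1)] unfolding j(2) .
        ultimately show ?thesis using \<open>M > 0\<close> by (auto simp: R_def)
      next
        case False
        have eq: "int (t + k) - int i = int t - int (i - k)" using False by (simp add: of_nat_diff)
        have ik: "i - k < n" using i by simp
        have "\<bar>vec n (\<lambda>k. y (int t - int k) \<omega>) $ (i - k)\<bar> \<le> vec_norm (vec n (\<lambda>k. y (int t - int k) \<omega>))"
          using ik by (intro abs_component_le_vec_norm) simp
        also have "\<dots> \<le> M" using Qt by (simp add: Q_def)
        finally have "\<bar>y (int (t + k) - int i) \<omega>\<bar> \<le> M" using ik unfolding eq by simp
        moreover have "0 \<le> (\<Sum>j<k. \<bar>a j\<bar> + \<bar>b j\<bar>)" by (intro sum_nonneg) auto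
        ultimately show ?thesis unfolding R_def atLeastAtMost_iff by linarith
      qed
      have "\<bar>u (t + k) \<omega>\<bar> \<le> (\<Sum>p<m. \<bar>coords m (\<theta> \<omega>) p * g p (y (int (t + k) - int (\<iota> p)) \<omega>)\<bar>)"
        unfolding u_def by (rule sum_abs)
      also have "\<dots> \<le> (\<Sum>p<m. \<bar>coords m (\<theta> \<omega>) p\<bar> * G p)"
        unfolding abs_mult by (intro sum_mono mult_left_mono G R \<iota>) simp_all
      finally show "\<bar>u (t + k) \<omega>\<bar> \<le> (\<Sum>p<m. \<bar>coords m (\<theta> \<omega>) p\<bar> * G p)" .
    qed
  qed

  \<comment> \<open>Finitely many target boxes and their visiting frequencies\<close>
  have nondeg': "\<exists>z. (\<Sum>p<m. g p (z (\<iota> p)) * x p) \<noteq> 0" if x: "(\<Sum>p<m. (x p)\<^sup>2) = 1" for x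
  proof -
    have "vec_norm (vec m x) = 1" using x by (simp add: vec_norm_eq)
    with nondeg[of "vec m x"] obtain z where z: "phi n ms f z \<bullet> vec m x \<noteq> 0" by auto
    have "phi n ms f z \<bullet> vec m x = (\<Sum>p<m. g p (z $ \<iota> p) * x p)"
      by (simp add: scalar_prod_def phi lessThan_atLeast0)
    then show ?thesis using z by (intro exI[of _ "\<lambda>i. z $ i"]) simp
  qed
  have "\<exists>(B :: ((nat \<Rightarrow> real) \<times> real) set) \<delta>. finite B \<and> 0 < \<delta> \<and> (\<forall>c\<in>B. 0 < snd c) \<and>
    (\<forall>x. (\<Sum>p<m. (x p)\<^sup>2) = 1 \<longrightarrow> (\<exists>c\<in>B. \<forall>z.
       (\<forall>k<n. \<bar>z k - fst c k\<bar> < snd c) \<longrightarrow> \<delta> \<le> \<bar>\<Sum>p<m. g p (z (\<iota> p)) * x p\<bar>))"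
    by (rule separable_features_boxes) (fact g \<iota> nondeg')+
  then obtain B :: "((nat \<Rightarrow> real) \<times> real) set" and \<delta> where B: "finite B" "\<forall>c\<in>B. 0 < snd c" and \<delta>: "0 < \<delta>"
    and boxes: "\<forall>x. (\<Sum>p<m. (x p)\<^sup>2) = 1 \<longrightarrow> (\<exists>c\<in>B. \<forall>z.
       (\<forall>k<n. \<bar>z k - fst c k\<bar> < snd c) \<longrightarrow> \<delta> \<le> \<bar>\<Sum>p<m. g p (z (\<iota> p)) * x p\<bar>)"
    by (elim exE conjE)
  \<comment> \<open>Regressors list the newest output first: the output at t + 1 + j is lag n - 1 -
    j of the regressor at t + n, so the box is traversed in reverse.\<close>
  define R where "R c t = {\<omega> \<in> Q t. \<forall>j<n. y (int (t + 1 + j)) \<omega> \<in> {fst c (n - 1 - j) - snd c<..<fst c (n - 1 - j) + snd c}}"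
    for c :: "(nat \<Rightarrow> real) \<times> real" and t
  have "AE \<omega> in Pr. \<forall>c\<in>B. (\<exists>\<^sub>\<infinity>t. \<omega> \<in> Q t) \<longrightarrow>
     (\<exists>e>0::real. \<forall>\<^sub>F T in sequentially. e * hits Q T \<omega> \<le> hits (R c) T \<omega>)"
  proof (rule AE_finite_allI[OF B(1)])
    fix c assume "c \<in> B"
    then have "snd c > 0" using B(2) by blast
    then show "AE \<omega> in Pr. (\<exists>\<^sub>\<infinity>t. \<omega> \<in> Q t) \<longrightarrow>
       (\<exists>e>0::real. \<forall>\<^sub>F T in sequentially. e * hits Q T \<omega> \<le> hits (R c) T \<omega>)"
      unfolding R_def
      using y_le by (intro AE_target_frequency[where y="\<lambda>t. y (int t)", OF _ u_hist Q_hist step _ bound]) auto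
  qed
  with AE_space show ?thesis
  proof (eventually_elim, intro impI)
    fix \<omega>
    assume sp: "\<omega> \<in> space Pr" and Om: "\<omega> \<in> Omega_set Pr n y M"
      and freq: "\<forall>c\<in>B. (\<exists>\<^sub>\<infinity>t. \<omega> \<in> Q t) \<longrightarrow>
         (\<exists>e>0::real. \<forall>\<^sub>F T in sequentially. e * hits Q T \<omega> \<le> hits (R c) T \<omega>)"
    have NQ: "N_count n y M t \<omega> \<le> hits Q (t + n) \<omega>" for t
      unfolding Q_def[abs_def] by (rule N_count_le_hits[OF assms(2) sp])
    have lim: "filterlim (\<lambda>t. N_count n y M t \<omega>) at_top sequentially" using Om by (simp add: Omega_set_def)
    have "\<exists>\<^sub>\<infinity>t. \<omega> \<in> Q t"
      unfolding frequently_iff_hits_unbounded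
    proof
      fix k :: nat
      from lim have "\<forall>\<^sub>F t in sequentially. real k \<le> N_count n y M t \<omega>" by (simp add: filterlim_at_top)
      then obtain t where "real k \<le> N_count n y M t \<omega>" by (auto simp: eventually_sequentially)
      then have "k \<le> hits Q (t + n) \<omega>" using NQ[of t] by linarith
      then show "\<exists>t. k \<le> hits Q t \<omega>" ..
    qed
    with freq have "\<forall>c\<in>B. \<exists>e>0::real. \<forall>\<^sub>F T in sequentially. e * hits Q T \<omega> \<le> hits (R c) T \<omega>" by simp
    from bchoice[OF this] obtain e where e: "\<And>c. c \<in> B \<Longrightarrow> e c > (0::real)"
      "\<And>c. c \<in> B \<Longrightarrow> \<forall>\<^sub>F T in sequentially. e c * hits Q T \<omega> \<le> hits (R c) T \<omega>" by auto
    define \<epsilon> where "\<epsilon> = Min (insert 1 (e ` B))"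
    have \<epsilon>: "\<epsilon> > 0" "\<And>c. c \<in> B \<Longrightarrow> \<epsilon> \<le> e c" using B(1) e(1) by (auto simp: \<epsilon>_def)
    have "\<forall>\<^sub>F T in sequentially. \<forall>c\<in>B. e c * hits Q T \<omega> \<le> hits (R c) T \<omega>"
      using e(2) B(1) by (intro eventually_ball_finite) auto
    then obtain T0 where T0: "\<And>T c. T \<ge> T0 \<Longrightarrow> c \<in> B \<Longrightarrow> e c * hits Q T \<omega> \<le> hits (R c) T \<omega>"
      by (auto simp: eventually_sequentially)
    \<comment> \<open>Passing from t + n to the cut-off \<open>T\<close> below loses at most 2n - 1
      counts, at most half of the total once the count reaches 4n.\<close>
    from lim have "\<forall>\<^sub>F t in sequentially. 4 * real n \<le> N_count n y M t \<omega>" by (simp add: filterlim_at_top)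
    \<comment> \<open>Each completed box visit contributes \<open>\<delta>\<^sup>2\<close>, visits
      have relative frequency at least \<open>\<epsilon>\<close>, and 1/2 pays for the boundary
      counts.\<close>
    then have "\<forall>\<^sub>F t in sequentially. ereal (\<delta>\<^sup>2 * \<epsilon> / 2) \<le>
        ereal (min_eigenvalue (info_matrix n ms f y t \<omega>) / N_count n y M t \<omega>)"
      using eventually_ge_at_top[of "T0 + n"]
    proof eventually_elim
      case (elim t)
      \<comment> \<open>A visit starting from the window at s is seen in the regressor at s + n, and
        s < \<open>T\<close> means s + n \<le> t.\<close>
      define T where "T = t + 1 - n"
      have T: "T \<ge> T0" "t + n = T + (2 * n - 1)" "t + 1 = T + n" using elim(2) assms(2) by (auto simp: T_def)
      have Npos: "N_count n y M t \<omega> > 0" using elim(1) assms(2) by simp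
      have "hits Q (t + n) \<omega> \<le> hits Q T \<omega> + (2 * n - 1)" unfolding T(2) by (rule hits_add_le)
      then have "real (hits Q (t + n) \<omega>) \<le> real (hits Q T \<omega>) + 2 * real n" using assms(2) by linarith
      then have NT: "N_count n y M t \<omega> / 2 \<le> hits Q T \<omega>" using NQ[of t] elim(1) by linarith
      have "\<delta>\<^sup>2 * \<epsilon> / 2 * N_count n y M t \<omega> \<le> min_eigenvalue (info_matrix n ms f y t \<omega>)"
      proof (rule min_eigenvalue_ge[OF _ m])
        show "info_matrix n ms f y t \<omega> \<in> carrier_mat m m" by (simp add: info_matrix_def m_def)
        show "info_matrix n ms f y t \<omega> $$ (i, j) = info_matrix n ms f y t \<omega> $$ (j, i)" if "i < m" "j < m" for i j
          using that by (auto simp: info_matrix_def m_def mult.commute)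
        fix x :: "nat \<Rightarrow> real" assume x: "(\<Sum>p<m. (x p)\<^sup>2) = 1"
        from boxes[rule_format, OF x] obtain c where c: "c \<in> B"
          "\<And>z. (\<forall>k<n. \<bar>z k - fst c k\<bar> < snd c) \<Longrightarrow> \<delta> \<le> \<bar>\<Sum>p<m. g p (z (\<iota> p)) * x p\<bar>" by blast
        define r where "r s = (\<Sum>p<m. regressor n ms f y s \<omega> $ p * x p)" for s
        have r: "\<delta>\<^sup>2 * of_bool (\<omega> \<in> R c s) \<le> (r (s + n))\<^sup>2" for s
        proof (cases "\<omega> \<in> R c s")
          case True
          have "\<bar>y (int (s + n) - int k) \<omega> - fst c k\<bar> < snd c" if "k < n" for k
          proof -
            define j where "j = n - 1 - k"
            have j: "j < n" "n - 1 - j = k" "int (s + n) - int k = int (s + 1 + j)" using that by (auto simp: j_def)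
            from True j(1) have "y (int (s + 1 + j)) \<omega> \<in> {fst c (n - 1 - j) - snd c<..<fst c (n - 1 - j) + snd c}"
              unfolding R_def by blast
            then have "y (int (s + n) - int k) \<omega> \<in> {fst c k - snd c<..<fst c k + snd c}"
              unfolding j(2,3) .
            then show ?thesis by auto
          qed
          then have "\<delta> \<le> \<bar>\<Sum>p<m. g p (y (int (s + n) - int (\<iota> p)) \<omega>) * x p\<bar>"
            by (intro c(2)[of "\<lambda>k. y (int (s + n) - int k) \<omega>"]) auto
          also have "(\<Sum>p<m. g p (y (int (s + n) - int (\<iota> p)) \<omega>) * x p) = r (s + n)"
            unfolding r_def by (intro sum.cong) (simp_all only: reg lessThan_iff)
          finally have "\<delta>\<^sup>2 \<le> \<bar>r (s + n)\<bar>\<^sup>2" using \<delta> by (intro power_mono) auto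
          then show ?thesis using True by simp
        qed simp
        have "\<delta>\<^sup>2 * \<epsilon> / 2 * N_count n y M t \<omega> = \<delta>\<^sup>2 * (\<epsilon> * (N_count n y M t \<omega> / 2))" by simp
        also have "\<dots> \<le> \<delta>\<^sup>2 * (e c * hits Q T \<omega>)"
          using \<epsilon> c(1) Npos NT less_imp_le[OF e(1)[OF c(1)]] by (intro mult_left_mono mult_mono) auto
        also have "\<dots> \<le> \<delta>\<^sup>2 * hits (R c) T \<omega>" by (intro mult_left_mono T0 T c(1)) simp
        also have "\<dots> = (\<Sum>s<T. \<delta>\<^sup>2 * of_bool (\<omega> \<in> R c s))" by (simp add: hits_def sum_distrib_left)
        also have "\<dots> \<le> (\<Sum>s<T. (r (s + n))\<^sup>2)" by (intro sum_mono r)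
        \<comment> \<open>Visits may overlap, but different starting times use different regressors,
          so nothing is counted twice.\<close>
        also have "\<dots> = (\<Sum>s\<in>(\<lambda>s. s + n) ` {..<T}. (r s)\<^sup>2)" by (subst sum.reindex) auto
        also have "\<dots> \<le> (\<Sum>s\<le>t. (r s)\<^sup>2)" using T(3) by (intro sum_mono2) auto
        also have "\<dots> \<le> (\<Sum>i<m. \<Sum>j<m. x i * info_matrix n ms f y t \<omega> $$ (i, j) * x j)"
          unfolding m_def info_matrix_quadratic_form r_def by (simp add: sum_nonneg)
        finally show "\<delta>\<^sup>2 * \<epsilon> / 2 * N_count n y M t \<omega> \<le> (\<Sum>i<m. \<Sum>j<m. x i * info_matrix n ms f y t \<omega> $$ (i, j) * x j)" .
      qed
      then show ?case using Npos by (simp add: field_simps)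
    qed
    then have "ereal (\<delta>\<^sup>2 * \<epsilon> / 2) \<le> liminf (\<lambda>t. ereal (min_eigenvalue (info_matrix n ms f y t \<omega>) / N_count n y M t \<omega>))"
      by (rule Liminf_bounded)
    moreover have "0 < ereal (\<delta>\<^sup>2 * \<epsilon> / 2)" using \<delta> \<epsilon> by simp
    ultimately show "0 < liminf (\<lambda>t. ereal (min_eigenvalue (info_matrix n ms f y t \<omega>) / N_count n y M t \<omega>))"
      by (rule less_le_trans[rotated])
  qed
qed

end
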